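(* Let $n\ge1$ and let $w'_n\in S_{n+2}$ be the permutation given in one-line notation by $(n+2)\,2\,3\cdots(n+1)\,1$, i.e. $w'_n(1)=n+2$, $w'_n(i)=i$ for $2\le i\le n+1$, and $w'_n(n+2)=1$. Then the multiplicity of the Schubert variety $X_{w'_n}\subseteq GL(n+2)/B$ at its most singular point, namely the point $X_e$ (the standard flag), equals the Catalan number $C_n=\frac{1}{n+1}\binom{2n}{n}$.
   Context: The group is $GL(m)=GL_m(\mathbb{C})$, $B\subset GL(m)$ is the subgroup of upper-triangular matrices, and $GL(m)/B$ is the variety of complete flags in $\mathbb{C}^m$: a matrix represents the flag whose $i$-dimensional subspace is spanned by its first $i$ columns. The standard flag $E$ is the one represented by the identity matrix. For $w\in S_m$, the Schubert variety $X_w$ is the closure of the left $B$-orbit of the flag whose $i$-th subspace is spanned by the standard basis vectors $e_{w(1)},\dots,e_{w(i)}$. For the identity permutation $e$, $X_e$ consists of the single point $E$, which lies in every $X_w$. The multiplicity of a variety $X$ at a point $p$ is the degree of the projective tangent cone $\operatorname{Proj}(\operatorname{gr}_{\mathfrak{m}_p}\mathcal{O}_{X,p})$ as a subvariety of the projective tangent space $\operatorname{Proj}(\operatorname{Sym}^*\mathfrak{m}_p/\mathfrak{m}_p^2)$, where $\mathfrak{m}_p$ is the maximal ideal of the local ring $\mathcal{O}_{X,p}$. "Most singular point" refers to the fact that, by semicontinuity, the multiplicity of $X_w$ at $X_e$ is at least its multiplicity at any other point. *)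

theory Defs
  imports
    "Jordan_Normal_Form.Matrix"
    "HOL-Algebra.QuotRing"
    "HOL-Algebra.Ideal_Product"
    "HOL-Algebra.Embedded_Algebras"
    "HOL-Analysis.Abstract_Topology"
    "HOL-Combinatorics.Permutations"
    "HOL-Computational_Algebra.Polynomial"
begin

section \<open>The variety of complete flags\<close>

definition GL :: "nat \<Rightarrow> complex mat set" where
  "GL m = {g \<in> carrier_mat m m. invertible_mat g}"

definition Borel :: "nat \<Rightarrow> complex mat set" where
  "Borel m = {b \<in> GL m. upper_triangular b}"

text \<open>
  A point of \<open>GL(m)/B\<close> is a coset \<open>gB\<close>; lemma \<open>flag_point_eq_iff\<close> below says that it is
  the same thing as the flag of the spans of the first \<open>i\<close> columns of \<open>g\<close>.
\<close>

definition flag_point :: "nat \<Rightarrow> complex mat \<Rightarrow> complex mat set" where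
  "flag_point m g = (\<lambda>b. g * b) ` Borel m"

definition flags :: "nat \<Rightarrow> complex mat set set" where
  "flags m = flag_point m ` GL m"

definition standard_flag :: "nat \<Rightarrow> complex mat set" where
  "standard_flag m = flag_point m (1\<^sub>m m)"

text \<open>The span of the first \<open>i\<close> columns of \<open>g\<close>.\<close>

definition column_span :: "nat \<Rightarrow> complex mat \<Rightarrow> nat \<Rightarrow> complex vec set" where
  "column_span m g i = {g *\<^sub>v c |c. c \<in> carrier_vec m \<and> (\<forall>j. i \<le> j \<and> j < m \<longrightarrow> c $ j = 0)}"

lemma GL_inverseE:
  assumes "g \<in> GL m"
  obtains g' where "g' \<in> carrier_mat m m" "g * g' = 1\<^sub>m m" "g' * g = 1\<^sub>m m"
proof -
  have g: "g \<in> carrier_mat m m" using assms by (simp add: GL_def)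
  obtain g' where g': "g * g' = 1\<^sub>m m" "g' * g = 1\<^sub>m (dim_row g')"
    using assms g unfolding GL_def invertible_mat_def inverts_mat_def by auto
  have "dim_col g' = m" using arg_cong[OF g'(1), of dim_col] by simp
  moreover have "dim_row g' = m" using arg_cong[OF g'(2), of dim_col] g by simp
  ultimately show ?thesis using that[of g'] g' by auto
qed

lemma GL_I:
  assumes "g \<in> carrier_mat m m" "g' \<in> carrier_mat m m" "g * g' = 1\<^sub>m m" "g' * g = 1\<^sub>m m"
  shows "g \<in> GL m"
proof -
  have "inverts_mat g g' \<and> inverts_mat g' g" using assms by (simp add: inverts_mat_def)
  thus ?thesis using assms(1) unfolding GL_def invertible_mat_def by auto
qed

lemma GL_mult_closed:
  assumes "g \<in> GL m" "h \<in> GL m"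
  shows "g * h \<in> GL m"
proof -
  have g: "g \<in> carrier_mat m m" and h: "h \<in> carrier_mat m m"
    using assms by (auto simp: GL_def)
  obtain g' where g': "g' \<in> carrier_mat m m" "g * g' = 1\<^sub>m m" "g' * g = 1\<^sub>m m"
    using GL_inverseE[OF assms(1)] .
  obtain h' where h': "h' \<in> carrier_mat m m" "h * h' = 1\<^sub>m m" "h' * h = 1\<^sub>m m"
    using GL_inverseE[OF assms(2)] .
  have hg: "h' * g' \<in> carrier_mat m m" and gh: "g * h \<in> carrier_mat m m"
    using g h g'(1) h'(1) by auto
  have "h * (h' * g') = g'"
    using assoc_mult_mat[OF h h'(1) g'(1)] h' g' by simp
  hence 1: "(g * h) * (h' * g') = 1\<^sub>m m"
    using assoc_mult_mat[OF g h hg] g' by simp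
  have "g' * (g * h) = h"
    using assoc_mult_mat[OF g'(1) g h] g' h by simp
  hence 2: "(h' * g') * (g * h) = 1\<^sub>m m"
    using assoc_mult_mat[OF h'(1) g'(1) gh] h' by simp
  show ?thesis using GL_I[OF gh hg 1 2] .
qed

lemma one_in_Borel: "1\<^sub>m m \<in> Borel m"
  using GL_I[of "1\<^sub>m m" m "1\<^sub>m m"] by (simp add: Borel_def)

lemma Borel_mult_closed:
  assumes "b \<in> Borel m" "c \<in> Borel m"
  shows "b * c \<in> Borel m"
proof -
  have b: "b \<in> carrier_mat m m" "upper_triangular b"
    and c: "c \<in> carrier_mat m m" "upper_triangular c"
    using assms by (auto simp: Borel_def GL_def)
  have "(b * c) $$ (i, j) = 0" if "i < m" "j < i" for i j
  proof -
    have "b $$ (i, k) * c $$ (k, j) = 0" if "k < m" for k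
      using b c that \<open>i < m\<close> \<open>j < i\<close> by (cases "k < i") (auto simp: upper_triangular_def)
    thus ?thesis using b(1) c(1) that by (auto simp: scalar_prod_def intro!: sum.neutral)
  qed
  hence "upper_triangular (b * c)" using b(1) by (auto simp: upper_triangular_def)
  thus ?thesis using assms GL_mult_closed by (auto simp: Borel_def)
qed

lemma column_span_mult_Borel:
  assumes g: "g \<in> carrier_mat m m" and b: "b \<in> Borel m"
  shows "column_span m (g * b) i \<subseteq> column_span m g i"
proof
  fix v assume "v \<in> column_span m (g * b) i"
  then obtain c where c: "v = (g * b) *\<^sub>v c" "c \<in> carrier_vec m"
    "\<forall>j. i \<le> j \<and> j < m \<longrightarrow> c $ j = 0"
    by (auto simp: column_span_def)
  have bc: "b \<in> carrier_mat m m" "upper_triangular b" using b by (auto simp: Borel_def GL_def)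
  have "(b *\<^sub>v c) $ j = 0" if "i \<le> j" "j < m" for j
  proof -
    have "b $$ (j, k) * c $ k = 0" if "k < m" for k
      using bc c(3) that \<open>i \<le> j\<close> \<open>j < m\<close> by (cases "k < j") (auto simp: upper_triangular_def)
    thus ?thesis using bc(1) c(2) that by (auto simp: scalar_prod_def intro!: sum.neutral)
  qed
  moreover have "v = g *\<^sub>v (b *\<^sub>v c)" using c g bc by (simp add: assoc_mult_mat_vec)
  moreover have "b *\<^sub>v c \<in> carrier_vec m" using bc c by simp
  ultimately show "v \<in> column_span m g i" unfolding column_span_def by blast
qed

lemma column_span_factor:
  assumes g: "g \<in> carrier_mat m m" and h: "h \<in> carrier_mat m m"
    and sub: "\<And>i. i \<le> m \<Longrightarrow> column_span m h i \<subseteq> column_span m g i"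
  obtains b where "b \<in> carrier_mat m m" "upper_triangular b" "h = g * b"
proof -
  have "\<exists>c. c \<in> carrier_vec m \<and> (\<forall>i. j < i \<and> i < m \<longrightarrow> c $ i = 0) \<and> col h j = g *\<^sub>v c" if "j < m" for j
  proof -
    have "h *\<^sub>v unit_vec m j \<in> column_span m h (Suc j)"
      unfolding column_span_def using that
      by (auto intro!: exI[of _ "unit_vec m j"])
    hence "h *\<^sub>v unit_vec m j \<in> column_span m g (Suc j)" using sub[of "Suc j"] that by auto
    moreover have "h *\<^sub>v unit_vec m j = col h j"
      using h that by (intro eq_vecI) auto
    ultimately show ?thesis unfolding column_span_def by (auto simp: Suc_le_eq)
  qed
  then obtain c where c: "\<And>j. j < m \<Longrightarrow> c j \<in> carrier_vec m"
    "\<And>j i. j < i \<Longrightarrow> i < m \<Longrightarrow> c j $ i = 0" "\<And>j. j < m \<Longrightarrow> col h j = g *\<^sub>v c j"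
    by (metis less_trans)
  define b where "b = mat m m (\<lambda>(i, j). c j $ i)"
  have b: "b \<in> carrier_mat m m" by (simp add: b_def)
  have "col b j = c j" if "j < m" for j
    using c(1)[OF that] that by (intro eq_vecI) (auto simp: b_def)
  hence "h = g * b"
    using g h b c(3) by (intro mat_col_eqI) (auto simp: col_mult2[of g m m b m])
  moreover have "upper_triangular b" using c(2) by (auto simp: b_def upper_triangular_def)
  ultimately show ?thesis using that b by blast
qed

lemma flag_point_eq_iff:
  assumes g: "g \<in> GL m" and h: "h \<in> GL m"
  shows "flag_point m g = flag_point m h \<longleftrightarrow> (\<forall>i\<le>m. column_span m g i = column_span m h i)"
proof
  have c: "g \<in> carrier_mat m m" "h \<in> carrier_mat m m" using g h by (auto simp: GL_def)
  assume eq: "flag_point m g = flag_point m h"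
  have "g * 1\<^sub>m m \<in> flag_point m g" "h * 1\<^sub>m m \<in> flag_point m h"
    unfolding flag_point_def using one_in_Borel by blast+
  hence "g \<in> flag_point m h" "h \<in> flag_point m g" using c eq by auto
  then obtain b b' where b: "b \<in> Borel m" "g = h * b" "b' \<in> Borel m" "h = g * b'"
    unfolding flag_point_def by blast
  show "\<forall>i\<le>m. column_span m g i = column_span m h i"
    using column_span_mult_Borel[OF c(2) b(1)] column_span_mult_Borel[OF c(1) b(3)] b(2,4)
    by (metis subset_antisym)
next
  have *: "flag_point m h \<subseteq> flag_point m g"
    if g: "g \<in> GL m" and h: "h \<in> GL m" and eq: "\<forall>i\<le>m. column_span m g i = column_span m h i" for g h
  proof -
    have c: "g \<in> carrier_mat m m" "h \<in> carrier_mat m m" using g h by (auto simp: GL_def)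
    obtain b where b: "b \<in> carrier_mat m m" "upper_triangular b" "h = g * b"
      using column_span_factor[OF c] eq by blast
    obtain b' where b': "b' \<in> carrier_mat m m" "upper_triangular b'" "g = h * b'"
      using column_span_factor[OF c(2,1)] eq by blast
    have factor_one: "c * d = 1\<^sub>m m"
      if x: "x \<in> GL m" and c: "c \<in> carrier_mat m m" and d: "d \<in> carrier_mat m m"
        and eq: "x = (x * c) * d" for x c d
    proof -
      have xc: "x \<in> carrier_mat m m" using x by (simp add: GL_def)
      obtain x' where x': "x' \<in> carrier_mat m m" "x * x' = 1\<^sub>m m" "x' * x = 1\<^sub>m m"
        using GL_inverseE[OF x] .
      have cd: "c * d \<in> carrier_mat m m" using c d by simp
      have "x = x * (c * d)" using eq assoc_mult_mat[OF xc c d] by simp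
      hence "x' * x = x' * (x * (c * d))" by (rule arg_cong)
      also have "\<dots> = (x' * x) * (c * d)" using assoc_mult_mat[OF x'(1) xc cd] by simp
      finally show ?thesis unfolding x'(3) left_mult_one_mat[OF cd] by (rule sym)
    qed
    have bb: "b * b' = 1\<^sub>m m" by (rule factor_one[OF g b(1) b'(1)], fold b(3), rule b'(3))
    have bb': "b' * b = 1\<^sub>m m" by (rule factor_one[OF h b'(1) b(1)], fold b'(3), rule b(3))
    have B: "b \<in> Borel m" using GL_I[OF b(1) b'(1) bb bb'] b(2) by (simp add: Borel_def)
    show ?thesis
    proof
      fix x assume "x \<in> flag_point m h"
      then obtain d where d: "d \<in> Borel m" "x = h * d" by (auto simp: flag_point_def)
      hence "d \<in> carrier_mat m m" by (auto simp: Borel_def GL_def)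
      hence "x = g * (b * d)" using assoc_mult_mat[OF c(1) b(1)] d b(3) by simp
      thus "x \<in> flag_point m g" using Borel_mult_closed[OF B d(1)] by (auto simp: flag_point_def)
    qed
  qed
  assume eq: "\<forall>i\<le>m. column_span m g i = column_span m h i"
  show "flag_point m g = flag_point m h" using *[OF g h] *[OF h g] eq by auto
qed

text \<open>
  Polynomial functions in the matrix entries. Since the ground field is infinite, they
  are the same as polynomials in \<open>m\<^sup>2\<close> variables.
\<close>

inductive_set poly_funs :: "nat \<Rightarrow> (complex mat \<Rightarrow> complex) set" for m where
  const: "(\<lambda>_. c) \<in> poly_funs m"
| entry: "i < m \<Longrightarrow> j < m \<Longrightarrow> (\<lambda>g. g $$ (i, j)) \<in> poly_funs m"
| add: "a \<in> poly_funs m \<Longrightarrow> b \<in> poly_funs m \<Longrightarrow> (\<lambda>g. a g + b g) \<in> poly_funs m"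
| mult: "a \<in> poly_funs m \<Longrightarrow> b \<in> poly_funs m \<Longrightarrow> (\<lambda>g. a g * b g) \<in> poly_funs m"

text \<open>The Zariski topology on \<open>GL(m)\<close>, and its quotient topology on \<open>GL(m)/B\<close>.\<close>

definition GL_top :: "nat \<Rightarrow> complex mat topology" where
  "GL_top m = topology_generated_by {{g \<in> GL m. a g \<noteq> 0} |a. a \<in> poly_funs m}"

definition flag_top :: "nat \<Rightarrow> complex mat set topology" where
  "flag_top m = topology (\<lambda>U. U \<subseteq> flags m \<and> openin (GL_top m) {g \<in> GL m. flag_point m g \<in> U})"

lemma topspace_GL_top: "topspace (GL_top m) = GL m"
proof -
  have "{g \<in> GL m. (1 :: complex) \<noteq> 0} \<in> {{g \<in> GL m. a g \<noteq> 0} |a. a \<in> poly_funs m}"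
    by (rule CollectI, rule exI[of _ "\<lambda>_. 1"]) (simp add: poly_funs.const)
  hence "GL m \<subseteq> \<Union>{{g \<in> GL m. a g \<noteq> 0} |a. a \<in> poly_funs m}"
    by (intro Union_upper) simp
  thus ?thesis unfolding GL_top_def topology_generated_by_topspace by (intro subset_antisym) auto
qed

lemma openin_flag_top:
  "openin (flag_top m) U \<longleftrightarrow>
     U \<subseteq> flags m \<and> openin (GL_top m) {g \<in> GL m. flag_point m g \<in> U}"
proof -
  have "istopology (\<lambda>U. U \<subseteq> flags m \<and> openin (GL_top m) {g \<in> GL m. flag_point m g \<in> U})"
    unfolding istopology_def
  proof (intro conjI allI impI; (elim conjE)?)
    fix S T assume "openin (GL_top m) {g \<in> GL m. flag_point m g \<in> S}"
      "openin (GL_top m) {g \<in> GL m. flag_point m g \<in> T}"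
    hence "openin (GL_top m) ({g \<in> GL m. flag_point m g \<in> S} \<inter> {g \<in> GL m. flag_point m g \<in> T})"
      by (rule openin_Int)
    also have "{g \<in> GL m. flag_point m g \<in> S} \<inter> {g \<in> GL m. flag_point m g \<in> T} =
        {g \<in> GL m. flag_point m g \<in> S \<inter> T}" by auto
    finally show "openin (GL_top m) {g \<in> GL m. flag_point m g \<in> S \<inter> T}" .
  next
    fix K assume K: "\<forall>S\<in>K. S \<subseteq> flags m \<and> openin (GL_top m) {g \<in> GL m. flag_point m g \<in> S}"
    hence "openin (GL_top m) (\<Union>S\<in>K. {g \<in> GL m. flag_point m g \<in> S})" by auto
    also have "(\<Union>S\<in>K. {g \<in> GL m. flag_point m g \<in> S}) = {g \<in> GL m. flag_point m g \<in> \<Union>K}"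
      by auto
    finally show "openin (GL_top m) {g \<in> GL m. flag_point m g \<in> \<Union>K}" .
  qed auto
  thus ?thesis unfolding flag_top_def by simp
qed

lemma topspace_flag_top: "topspace (flag_top m) = flags m"
proof -
  have "{g \<in> GL m. flag_point m g \<in> flags m} = GL m" by (auto simp: flags_def)
  hence "openin (flag_top m) (flags m)"
    unfolding openin_flag_top using openin_topspace[of "GL_top m"] by (simp add: topspace_GL_top)
  thus ?thesis using openin_flag_top openin_subset by (metis openin_topspace subset_antisym)
qed

lemma quotient_map_flag_point: "quotient_map (GL_top m) (flag_top m) (flag_point m)"
  unfolding quotient_map_def topspace_GL_top topspace_flag_top openin_flag_top
  by (simp add: flags_def)

text \<open>
  The regular functions on \<open>GL(m)\<close> are locally fractions of polynomials; those on the
  quotient \<open>GL(m)/B\<close> are the ones whose pullback to \<open>GL(m)\<close> is regular.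
  Both definitions are meant for open domains.
\<close>

definition regular_on_GL :: "nat \<Rightarrow> complex mat set \<Rightarrow> (complex mat \<Rightarrow> complex) \<Rightarrow> bool" where
  "regular_on_GL m V h \<longleftrightarrow>
     (\<forall>g\<in>V. \<exists>a\<in>poly_funs m. \<exists>b\<in>poly_funs m. \<exists>W. openin (GL_top m) W \<and> g \<in> W \<and> W \<subseteq> V \<and>
        (\<forall>x\<in>W. b x \<noteq> 0 \<and> h x = a x / b x))"

definition regular_on_flags ::
    "nat \<Rightarrow> complex mat set set \<Rightarrow> (complex mat set \<Rightarrow> complex) \<Rightarrow> bool" where
  "regular_on_flags m U h \<longleftrightarrow>
     regular_on_GL m {g \<in> GL m. flag_point m g \<in> U} (\<lambda>g. h (flag_point m g))"


lemma regular_on_flags_const: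
  assumes "openin (flag_top m) U"
  shows "regular_on_flags m U (\<lambda>_. c)"
  unfolding regular_on_flags_def regular_on_GL_def
proof
  fix g assume g: "g \<in> {g \<in> GL m. flag_point m g \<in> U}"
  have "openin (GL_top m) {g \<in> GL m. flag_point m g \<in> U}" using assms by (simp add: openin_flag_top)
  with g show "\<exists>a\<in>poly_funs m. \<exists>b\<in>poly_funs m. \<exists>W. openin (GL_top m) W \<and> g \<in> W \<and>
      W \<subseteq> {g \<in> GL m. flag_point m g \<in> U} \<and> (\<forall>x\<in>W. b x \<noteq> 0 \<and> c = a x / b x)"
    by (intro bexI[of _ "\<lambda>_. c"] bexI[of _ "\<lambda>_. 1"] exI[of _ "{g \<in> GL m. flag_point m g \<in> U}"]
        poly_funs.const) simp
qed

lemma regular_on_flags_combine: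
  assumes "regular_on_flags m U h" "regular_on_flags m V k"
  shows "regular_on_flags m (U \<inter> V) (\<lambda>x. h x + k x)"
    and "regular_on_flags m (U \<inter> V) (\<lambda>x. h x * k x)"
proof -
  let ?U = "{g \<in> GL m. flag_point m g \<in> U}" and ?V = "{g \<in> GL m. flag_point m g \<in> V}"
  have *: "regular_on_GL m (?U \<inter> ?V) (\<lambda>g. h (flag_point m g) + k (flag_point m g)) \<and>
           regular_on_GL m (?U \<inter> ?V) (\<lambda>g. h (flag_point m g) * k (flag_point m g))"
    unfolding regular_on_GL_def
  proof (intro conjI ballI)
    fix g assume g: "g \<in> ?U \<inter> ?V"
    obtain a b W where 1: "a \<in> poly_funs m" "b \<in> poly_funs m" "openin (GL_top m) W" "g \<in> W"
      "W \<subseteq> ?U" "\<forall>x\<in>W. b x \<noteq> 0 \<and> h (flag_point m x) = a x / b x"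
      using assms(1) g unfolding regular_on_flags_def regular_on_GL_def by (meson IntD1)
    obtain a' b' W' where 2: "a' \<in> poly_funs m" "b' \<in> poly_funs m" "openin (GL_top m) W'" "g \<in> W'"
      "W' \<subseteq> ?V" "\<forall>x\<in>W'. b' x \<noteq> 0 \<and> k (flag_point m x) = a' x / b' x"
      using assms(2) g unfolding regular_on_flags_def regular_on_GL_def by (meson IntD2)
    show "\<exists>a\<in>poly_funs m. \<exists>b\<in>poly_funs m. \<exists>W. openin (GL_top m) W \<and> g \<in> W \<and> W \<subseteq> ?U \<inter> ?V \<and>
        (\<forall>x\<in>W. b x \<noteq> 0 \<and> h (flag_point m x) + k (flag_point m x) = a x / b x)"
    proof (rule bexI[where x = "\<lambda>x. a x * b' x + a' x * b x"], rule bexI[where x = "\<lambda>x. b x * b' x"],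
        rule exI[where x = "W \<inter> W'"], intro conjI)
      show "openin (GL_top m) (W \<inter> W')" using 1 2 by (simp add: openin_Int)
      show "(\<lambda>x. a x * b' x + a' x * b x) \<in> poly_funs m"
        by (intro poly_funs.add poly_funs.mult 1 2)
      show "(\<lambda>x. b x * b' x) \<in> poly_funs m" by (intro poly_funs.mult 1 2)
      show "g \<in> W \<inter> W'" using 1 2 by simp
      show "W \<inter> W' \<subseteq> ?U \<inter> ?V" using 1(5) 2(5) by (rule Int_mono)
      show "\<forall>x\<in>W \<inter> W'. b x * b' x \<noteq> 0 \<and> h (flag_point m x) + k (flag_point m x) =
              (a x * b' x + a' x * b x) / (b x * b' x)"
        using 1(6) 2(6) by (simp add: add_frac_eq)
    qed
    show "\<exists>a\<in>poly_funs m. \<exists>b\<in>poly_funs m. \<exists>W. openin (GL_top m) W \<and> g \<in> W \<and> W \<subseteq> ?U \<inter> ?V \<and>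
        (\<forall>x\<in>W. b x \<noteq> 0 \<and> h (flag_point m x) * k (flag_point m x) = a x / b x)"
    proof (rule bexI[where x = "\<lambda>x. a x * a' x"], rule bexI[where x = "\<lambda>x. b x * b' x"],
        rule exI[where x = "W \<inter> W'"], intro conjI)
      show "openin (GL_top m) (W \<inter> W')" using 1 2 by (simp add: openin_Int)
      show "(\<lambda>x. a x * a' x) \<in> poly_funs m" by (intro poly_funs.mult 1 2)
      show "(\<lambda>x. b x * b' x) \<in> poly_funs m" by (intro poly_funs.mult 1 2)
      show "g \<in> W \<inter> W'" using 1 2 by simp
      show "W \<inter> W' \<subseteq> ?U \<inter> ?V" using 1(5) 2(5) by (rule Int_mono)
      show "\<forall>x\<in>W \<inter> W'. b x * b' x \<noteq> 0 \<and> h (flag_point m x) * k (flag_point m x) =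
              (a x * a' x) / (b x * b' x)"
        using 1(6) 2(6) by simp
    qed
  qed
  have "?U \<inter> ?V = {g \<in> GL m. flag_point m g \<in> U \<inter> V}" by auto
  thus "regular_on_flags m (U \<inter> V) (\<lambda>x. h x + k x)" "regular_on_flags m (U \<inter> V) (\<lambda>x. h x * k x)"
    using * unfolding regular_on_flags_def by simp_all
qed


section \<open>Schubert varieties\<close>

text \<open>
  A permutation \<open>w\<close> is a function on \<open>{1..m}\<close>; matrix indices start at \<open>0\<close>.
  Column number \<open>j\<close> of the matrix is the standard basis vector number \<open>w j\<close>.
\<close>

definition perm_matrix :: "nat \<Rightarrow> (nat \<Rightarrow> nat) \<Rightarrow> complex mat" where
  "perm_matrix m w = mat m m (\<lambda>(i, j). if Suc i = w (Suc j) then 1 else 0)"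

definition Schubert_variety :: "nat \<Rightarrow> (nat \<Rightarrow> nat) \<Rightarrow> complex mat set set" where
  "Schubert_variety m w =
     flag_top m closure_of {flag_point m (b * perm_matrix m w) |b. b \<in> Borel m}"

definition w' :: "nat \<Rightarrow> nat \<Rightarrow> nat" where
  "w' n i = (if i = 1 then n + 2 else if i = n + 2 then 1 else i)"


lemma w'_permutes: "w' n permutes {1..n + 2}"
proof -
  have "w' n = Transposition.transpose 1 (n + 2)"
    by (rule ext) (simp add: w'_def Transposition.transpose_def)
  thus ?thesis using permutes_swap_id[of 1 "{1..n + 2}" "n + 2"] by simp
qed


section \<open>Local rings\<close>

text \<open>
  The local ring of a closed subvariety \<open>X\<close> of \<open>GL(m)/B\<close> at a point \<open>p\<close>, as the ring of
  germs: functions that near \<open>p\<close> are restrictions to \<open>X\<close> of regular functions, modulo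
  those that vanish on \<open>X\<close> near \<open>p\<close>. The values away from \<open>p\<close> or outside \<open>X\<close> of the
  functions are immaterial.
\<close>

definition regular_near ::
    "nat \<Rightarrow> complex mat set set \<Rightarrow> complex mat set \<Rightarrow> (complex mat set \<Rightarrow> complex) set" where
  "regular_near m X p = {f. \<exists>U h. openin (flag_top m) U \<and> p \<in> U \<and> regular_on_flags m U h \<and>
                                   (\<forall>x\<in>X \<inter> U. f x = h x)}"

definition vanishing_near ::
    "nat \<Rightarrow> complex mat set set \<Rightarrow> complex mat set \<Rightarrow> (complex mat set \<Rightarrow> complex) set" where
  "vanishing_near m X p = {f. \<exists>U. openin (flag_top m) U \<and> p \<in> U \<and> (\<forall>x\<in>X \<inter> U. f x = 0)}"

definition regular_near_ring ::
    "nat \<Rightarrow> complex mat set set \<Rightarrow> complex mat set \<Rightarrow> (complex mat set \<Rightarrow> complex) ring" where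
  "regular_near_ring m X p =
     \<lparr>carrier = regular_near m X p, mult = \<lambda>f g x. f x * g x, one = \<lambda>_. 1,
      zero = \<lambda>_. 0, add = \<lambda>f g x. f x + g x\<rparr>"

lemma regular_near_const:
  assumes "p \<in> flags m"
  shows "(\<lambda>_. c) \<in> regular_near m X p"
proof -
  have "openin (flag_top m) (flags m)" using openin_topspace[of "flag_top m"] by (simp add: topspace_flag_top)
  with assms regular_on_flags_const[OF this, of c] show ?thesis unfolding regular_near_def by blast
qed

lemma regular_near_combine:
  assumes "f \<in> regular_near m X p" "g \<in> regular_near m X p"
  shows "(\<lambda>x. f x + g x) \<in> regular_near m X p" "(\<lambda>x. f x * g x) \<in> regular_near m X p"
proof -
  obtain U h where 1: "openin (flag_top m) U" "p \<in> U" "regular_on_flags m U h" "\<forall>x\<in>X \<inter> U. f x = h x"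
    using assms(1) unfolding regular_near_def by blast
  obtain V k where 2: "openin (flag_top m) V" "p \<in> V" "regular_on_flags m V k" "\<forall>x\<in>X \<inter> V. g x = k x"
    using assms(2) unfolding regular_near_def by blast
  have o: "openin (flag_top m) (U \<inter> V)" "p \<in> U \<inter> V" using 1 2 by (auto simp: openin_Int)
  have "\<forall>x\<in>X \<inter> (U \<inter> V). f x + g x = h x + k x" "\<forall>x\<in>X \<inter> (U \<inter> V). f x * g x = h x * k x"
    using 1(4) 2(4) by simp_all
  with o regular_on_flags_combine[OF 1(3) 2(3)]
  show "(\<lambda>x. f x + g x) \<in> regular_near m X p" "(\<lambda>x. f x * g x) \<in> regular_near m X p"
    unfolding regular_near_def by blast+
qed

lemma cring_regular_near_ring:
  assumes p: "p \<in> flags m"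
  shows "cring (regular_near_ring m X p)"
proof (rule cringI)
  have "\<exists>g\<in>regular_near m X p. (\<lambda>x. g x + f x) = (\<lambda>_. 0)" if "f \<in> regular_near m X p" for f
    using regular_near_combine(2)[OF regular_near_const[OF p, of "- 1"] that] by (rule bexI[rotated]) simp
  thus "abelian_group (regular_near_ring m X p)"
    by (intro abelian_groupI)
      (auto simp: regular_near_ring_def regular_near_combine regular_near_const[OF p] add_ac)
  show "Group.comm_monoid (regular_near_ring m X p)"
    by (intro comm_monoidI)
      (auto simp: regular_near_ring_def regular_near_combine regular_near_const[OF p] mult_ac)
qed (auto simp: regular_near_ring_def algebra_simps)

lemma vanishing_near_subset: "p \<in> flags m \<Longrightarrow> vanishing_near m X p \<subseteq> regular_near m X p"
  unfolding vanishing_near_def regular_near_def using regular_on_flags_const by fastforce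

lemma ideal_vanishing_near:
  assumes p: "p \<in> flags m"
  shows "ideal (vanishing_near m X p) (regular_near_ring m X p)"
proof -
  interpret cring "regular_near_ring m X p" by (rule cring_regular_near_ring[OF p])
  have add: "(\<lambda>x. f x + g x) \<in> vanishing_near m X p"
    if "f \<in> vanishing_near m X p" "g \<in> vanishing_near m X p" for f g
  proof -
    obtain U V where "openin (flag_top m) U" "p \<in> U" "\<forall>x\<in>X \<inter> U. f x = 0"
      "openin (flag_top m) V" "p \<in> V" "\<forall>x\<in>X \<inter> V. g x = 0"
      using \<open>f \<in> _\<close> \<open>g \<in> _\<close> unfolding vanishing_near_def by blast
    thus ?thesis unfolding vanishing_near_def by (auto intro!: exI[of _ "U \<inter> V"])
  qed
  have mult: "(\<lambda>x. f x * g x) \<in> vanishing_near m X p" "(\<lambda>x. g x * f x) \<in> vanishing_near m X p"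
    if "f \<in> vanishing_near m X p" for f g
    using that unfolding vanishing_near_def by auto
  have "openin (flag_top m) (flags m)" using openin_topspace[of "flag_top m"] by (simp add: topspace_flag_top)
  hence zero: "(\<lambda>_. 0) \<in> vanishing_near m X p" unfolding vanishing_near_def using p by auto
  have "inv\<^bsub>add_monoid (regular_near_ring m X p)\<^esub> f \<in> vanishing_near m X p"
    if f: "f \<in> vanishing_near m X p" for f
  proof -
    have mf: "(\<lambda>x. (- 1) * f x) \<in> vanishing_near m X p" by (rule mult(2)[OF f])
    have "\<ominus>\<^bsub>regular_near_ring m X p\<^esub> f = (\<lambda>x. (- 1) * f x)"
      using f mf vanishing_near_subset[OF p, of X]
      by (intro minus_equality) (auto simp: regular_near_ring_def)
    thus ?thesis using mf by (simp add: a_inv_def)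
  qed
  thus ?thesis
    using add mult zero vanishing_near_subset[OF p]
    by (intro idealI subgroup.intro ring_axioms) (auto simp: regular_near_ring_def)
qed

definition germ ::
    "nat \<Rightarrow> complex mat set set \<Rightarrow> complex mat set \<Rightarrow> (complex mat set \<Rightarrow> complex) \<Rightarrow>
     (complex mat set \<Rightarrow> complex) set" where
  "germ m X p f = vanishing_near m X p +>\<^bsub>regular_near_ring m X p\<^esub> f"

definition local_ring ::
    "nat \<Rightarrow> complex mat set set \<Rightarrow> complex mat set \<Rightarrow> (complex mat set \<Rightarrow> complex) set ring" where
  "local_ring m X p = regular_near_ring m X p Quot vanishing_near m X p"

definition local_max_ideal ::
    "nat \<Rightarrow> complex mat set set \<Rightarrow> complex mat set \<Rightarrow> (complex mat set \<Rightarrow> complex) set set" where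
  "local_max_ideal m X p = {germ m X p f |f. f \<in> regular_near m X p \<and> f p = 0}"

definition local_constants ::
    "nat \<Rightarrow> complex mat set set \<Rightarrow> complex mat set \<Rightarrow> (complex mat set \<Rightarrow> complex) set set" where
  "local_constants m X p = range (\<lambda>c. germ m X p (\<lambda>_. c))"


section \<open>Multiplicity\<close>

primrec ideal_power :: "('a, 'b) ring_scheme \<Rightarrow> 'a set \<Rightarrow> nat \<Rightarrow> 'a set" where
  "ideal_power R I 0 = carrier R"
| "ideal_power R I (Suc k) = ideal_prod R I (ideal_power R I k)"

text \<open>
  The Hilbert function of the associated graded ring of \<open>R\<close> with respect to \<open>M\<close>, which is
  the homogeneous coordinate ring of the projective tangent cone. Its part of degree \<open>k\<close>,
  which is \<open>M\<^sup>k / M\<^sup>k\<^sup>+\<^sup>1\<close>, is a subspace of \<open>R / M\<^sup>k\<^sup>+\<^sup>1\<close>. The dimension is over (the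
  image of) \<open>K\<close>, a field contained in \<open>R\<close>.
\<close>

definition gr_Hilbert_function ::
    "('a, 'b) ring_scheme \<Rightarrow> 'a set \<Rightarrow> 'a set \<Rightarrow> nat \<Rightarrow> nat" where
  "gr_Hilbert_function R K M k =
     (let J = ideal_power R M (Suc k)
      in ring.dim (R Quot J) ((\<lambda>x. J +>\<^bsub>R\<^esub> x) ` K) ((\<lambda>x. J +>\<^bsub>R\<^esub> x) ` ideal_power R M k))"

definition Hilbert_polynomial :: "(nat \<Rightarrow> nat) \<Rightarrow> rat poly" where
  "Hilbert_polynomial H = (THE P. \<forall>\<^sub>F k in sequentially. poly P (of_nat k) = of_nat (H k))"

text \<open>
  The degree of a closed subscheme of projective space whose homogeneous coordinate ring has
  the Hilbert function \<open>H\<close>: \<open>d!\<close> times the leading coefficient of the Hilbert polynomial,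
  where \<open>d\<close> is the dimension of the subscheme, i.e. the degree of the polynomial.
  The empty subscheme (the projective tangent cone at an isolated point) has degree \<open>0\<close>.
\<close>

definition projective_degree :: "(nat \<Rightarrow> nat) \<Rightarrow> rat" where
  "projective_degree H =
     (let P = Hilbert_polynomial H in fact (Polynomial.degree P) * Polynomial.lead_coeff P)"

definition multiplicity_at :: "nat \<Rightarrow> complex mat set set \<Rightarrow> complex mat set \<Rightarrow> rat" where
  "multiplicity_at m X p =
     projective_degree
       (gr_Hilbert_function (local_ring m X p) (local_constants m X p) (local_max_ideal m X p))"

end

theory Submission
  imports Defs "Jordan_Normal_Form.Determinant" "HOL-Library.Landau_Symbols"
begin

text \<open>
  Near the standard flag \<open>E\<close> the flag variety has the coordinates \<open>x r c\<close> (\<open>r > c\<close>) given by the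
  lower unitriangular matrices. On the \<open>B\<close>-orbit of the permutation the rank of every block strictly
  below the diagonal is at most one, so there \<open>x r c = u r * v c\<close>, and on its closure a monomial
  depends only on its multiset of rows and its multiset of columns. Hence \<open>M\<^sup>k / M\<^sup>k\<^sup>+\<^sup>1\<close> is
  spanned by the monomials \<open>\<Prod>i<k. x (r i) (c i)\<close> with both sequences \<open>r\<close>, \<open>c\<close> sorted and
  \<open>c i < r i\<close>. They are linearly independent: along the curve with coordinates \<open>t * u r * v c\<close> an
  element of \<open>M\<^sup>k\<^sup>+\<^sup>1\<close> is \<open>O(t\<^sup>k\<^sup>+\<^sup>1)\<close>, while the monomials are \<open>t\<^sup>k\<close> times distinct monomials in
  \<open>u\<close> and \<open>v\<close>. The pairs of sequences are counted by a \<open>2 \<times> 2\<close> Lindstrom--Gessel--Viennot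
  determinant, a polynomial in \<open>k\<close> of degree \<open>2 n\<close> with leading coefficient \<open>1 / (n! (n + 1)!)\<close>.
\<close>

text \<open>Neither the ideal of the variety nor the relations of the associated graded ring are
  ever determined. In each degree the sorted monomials are confirmed as a basis from two sides:
  spanning uses equations that hold on the orbit and hence on its closure, independence uses only
  curves that lie in the orbit for small nonzero \<open>t\<close> and tend to \<open>E\<close>. The
  two sides meet in the same family because sorting two sequences with \<open>c i < r i\<close>
  separately keeps these inequalities; a sorted monomial still involves only coordinates strictly
  below the diagonal. There are \<open>n + 1\<close> columns \<open>0..n\<close> and
  \<open>n + 1\<close> rows \<open>1..n + 1\<close>, so sorted sequences of length \<open>k\<close>
  number \<open>(n + k) choose k\<close> on either side. The first term of the determinant counts
  all pairs, and the second one the pairs that violate some \<open>c i < r i\<close>. Both grow like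
  \<open>k ^ (2 * n)\<close>, and the Catalan number comes from the difference of their leading
  coefficients.\<close>

section \<open>Sorted pairs of sequences\<close>

text \<open>The columns come first in the pair. The bounds for columns and rows are separate because
  the count recurses on the last entries. The shift in \<open>Suc b\<close> turns the strict
  inequality between the last entries into \<open>a' \<le> b'\<close>.\<close>

definition staircase_pairs :: "nat \<Rightarrow> nat \<Rightarrow> nat \<Rightarrow> (nat list \<times> nat list) set" where
  "staircase_pairs k a b = {(cs, rs). length cs = k \<and> list_all2 (<) cs rs \<and> sorted cs \<and> sorted rs \<and>
     set cs \<subseteq> {..a} \<and> set rs \<subseteq> {..Suc b}}"

lemma finite_staircase_pairs: "finite (staircase_pairs k a b)"
proof -
  have "staircase_pairs k a b \<subseteq> {xs. set xs \<subseteq> {..a} \<and> length xs = k} \<times> {xs. set xs \<subseteq> {..Suc b} \<and> length xs = k}"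
    by (auto simp: staircase_pairs_def list_all2_lengthD)
  thus ?thesis by (rule finite_subset) (auto intro: finite_lists_length_eq)
qed

lemma staircase_pairs_0: "staircase_pairs 0 a b = {([], [])}"
  by (auto simp: staircase_pairs_def)

text \<open>In sorted sequences the last entries bound all others, so after their removal they serve
  as the new bounds.\<close>

lemma staircase_pairs_Suc:
  "staircase_pairs (Suc k) a b =
     (\<Union>a'\<in>{..a}. \<Union>b'\<in>{a'..b}. (\<lambda>(cs, rs). (cs @ [a'], rs @ [Suc b'])) ` staircase_pairs k a' b')"
  (is "?L = ?R")
proof
  show "?L \<subseteq> ?R"
  proof
    fix p assume "p \<in> ?L"
    then obtain cs rs where p: "p = (cs, rs)" "length cs = Suc k" "list_all2 (<) cs rs" "sorted cs" "sorted rs"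
      "set cs \<subseteq> {..a}" "set rs \<subseteq> {..Suc b}" by (auto simp: staircase_pairs_def)
    obtain cs' a' where cs: "cs = cs' @ [a']" using p(2) by (cases cs rule: rev_cases) auto
    obtain rs' r where rs: "rs = rs' @ [r]" using p(2,3) by (cases rs rule: rev_cases) auto
    have len: "length cs' = length rs'" using p(3) cs rs by (auto dest: list_all2_lengthD)
    have *: "list_all2 (<) cs' rs'" "a' < r" using p(3) len unfolding cs rs by (auto simp: list_all2_append)
    then obtain b' where b': "r = Suc b'" by (cases r) auto
    have "(cs', rs') \<in> staircase_pairs k a' b'"
      using p * unfolding cs rs b' by (auto simp: staircase_pairs_def sorted_append)
    moreover have "a' \<le> a" "a' \<le> b'" "b' \<le> b" using p * cs rs b' by auto
    ultimately show "p \<in> ?R" unfolding p(1) cs rs b' by fastforce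
  qed
  show "?R \<subseteq> ?L"
    by (auto simp: staircase_pairs_def sorted_append list_all2_append list_all2_lengthD)
qed

lemma card_staircase_pairs_Suc:
  "card (staircase_pairs (Suc k) a b) = (\<Sum>a'\<le>a. \<Sum>b'=a'..b. card (staircase_pairs k a' b'))"
proof -
  have inj: "inj_on (\<lambda>(cs, rs). (cs @ [a'], rs @ [Suc b'])) A" for a' b' A
    by (auto simp: inj_on_def)
  have "card (staircase_pairs (Suc k) a b) =
    (\<Sum>a'\<in>{..a}. card (\<Union>b'\<in>{a'..b}. (\<lambda>(cs, rs). (cs @ [a'], rs @ [Suc b'])) ` staircase_pairs k a' b'))"
    unfolding staircase_pairs_Suc by (subst card_UN_disjoint) (auto simp: finite_staircase_pairs)
  also have "\<dots> = (\<Sum>a'\<le>a. \<Sum>b'=a'..b. card (staircase_pairs k a' b'))"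
    by (intro sum.cong refl, subst card_UN_disjoint) (auto simp: finite_staircase_pairs card_image[OF inj])
  finally show ?thesis .
qed

text \<open>Both binomials in \<open>b'\<close> have hockey-stick sums, and their boundary terms at
  the lower end \<open>b' = a\<close> yield the same product
  \<open>((a + k) choose k) * ((a + k) choose (Suc k))\<close>, which cancels. The lower index
  \<open>Suc b'\<close>, in place of \<open>k - 1\<close>, gives the right value 0 at
  \<open>k = 0\<close>.\<close>

lemma sum_ballot_inner:
  assumes "a \<le> b"
  shows "(\<Sum>b'=a..b. int ((a + k) choose k) * int ((b' + k) choose k)
             - int ((a + k) choose (Suc k)) * int ((b' + k) choose (Suc b')))
    = int ((a + k) choose k) * int (Suc (b + k) choose (Suc k))
        - int ((a + k) choose (Suc k)) * int (Suc (b + k) choose (Suc b))"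
  using assms
proof (induction b rule: dec_induct)
  case base
  have "a + k choose a = a + k choose k" by (metis binomial_symmetric diff_add_inverse2 le_add2 add.commute le_add1 diff_add_inverse)
  thus ?case by (simp add: algebra_simps)
next
  case (step b)
  have "Suc (Suc (b + k)) choose Suc (Suc b) = (Suc (b + k) choose Suc b) + (Suc (b + k) choose Suc (Suc b))"
    "Suc (Suc (b + k)) choose (Suc k) = (Suc (b + k) choose k) + (Suc (b + k) choose (Suc k))"
    by simp_all
  thus ?case using step by (simp del: binomial_Suc_Suc add: algebra_simps)
qed

text \<open>The two products are the terms of the Lindstrom--Gessel--Viennot determinant.\<close>

lemma card_staircase_pairs:
  assumes "a \<le> b"
  shows "int (card (staircase_pairs k a b)) =
    int ((a + k) choose k) * int ((b + k) choose k)
      - int ((a + k) choose (Suc k)) * int ((b + k) choose (Suc b))"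
  using assms
proof (induction k arbitrary: a b)
  case 0
  show ?case by (simp add: staircase_pairs_0)
next
  case (Suc k)
  have "int (card (staircase_pairs (Suc k) a b)) =
    (\<Sum>a'\<le>a. \<Sum>b'=a'..b. int (card (staircase_pairs k a' b')))"
    by (simp add: card_staircase_pairs_Suc)
  also have "\<dots> = (\<Sum>a'\<le>a. int ((a' + k) choose k) * int (Suc (b + k) choose (Suc k))
        - int ((a' + k) choose (Suc k)) * int (Suc (b + k) choose (Suc b)))"
  proof (intro sum.cong refl, goal_cases)
    case (1 a')
    hence "a' \<le> b" using Suc.prems by simp
    have "(\<Sum>b'=a'..b. int (card (staircase_pairs k a' b'))) = (\<Sum>b'=a'..b. int ((a' + k) choose k) * int ((b' + k) choose k)
             - int ((a' + k) choose (Suc k)) * int ((b' + k) choose (Suc b')))"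
      by (intro sum.cong refl Suc.IH) auto
    thus ?case using sum_ballot_inner[OF \<open>a' \<le> b\<close>, of k] by simp
  qed
  \<comment> \<open>The sums over \<open>a'\<close> start at 0, so this time the hockey-stick
    identity leaves no boundary term.\<close>
  also have "\<dots> = int (Suc (a + k) choose (Suc k)) * int (Suc (b + k) choose (Suc k))
        - int (Suc (a + k) choose (Suc (Suc k))) * int (Suc (b + k) choose (Suc b))"
  proof (induction a)
    case (Suc a)
    have "Suc (Suc (a + k)) choose Suc k = (Suc (a + k) choose k) + (Suc (a + k) choose Suc k)"
      "Suc (Suc (a + k)) choose (Suc (Suc k)) = (Suc (a + k) choose Suc k) + (Suc (a + k) choose (Suc (Suc k)))"
      by simp_all
    with Suc show ?case by (simp del: binomial_Suc_Suc add: algebra_simps)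
  qed simp
  finally show ?case by simp
qed

text \<open>This keeps the product of a sorted monomial with one coordinate, once sorted again,
  inside the staircase. If the two new entries part at the heads, then
  \<open>x \<le> a < b < y\<close> or \<open>a < x < y \<le> b\<close>, and either chain gives the
  inequality for the new pair of heads and for the pair that is inserted into the tails.\<close>

lemma list_all2_less_insort:
  fixes x y :: "'a :: linorder"
  assumes "list_all2 (<) xs ys" "sorted xs" "sorted ys" "x < y"
  shows "list_all2 (<) (insort x xs) (insort y ys)"
  using assms
proof (induction xs ys arbitrary: x y rule: list_all2_induct)
  case (Cons a as b bs)
  have ia: "insort a as = a # as" and ib: "insort b bs = b # bs"
    using Cons.prems by (cases as; auto; fail) (cases bs; use Cons.prems in auto; fail)
  have s: "sorted as" "sorted bs" using Cons.prems by auto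
  consider "x \<le> a" "y \<le> b" | "x \<le> a" "b < y" | "a < x" "y \<le> b" | "a < x" "b < y" by fastforce
  thus ?case
  proof cases
    case 2
    have "list_all2 (<) (insort a as) (insort y bs)" using Cons.IH[OF s, of a y] Cons.hyps 2 by auto
    thus ?thesis using 2 Cons ia by auto
  next
    case 3
    have "list_all2 (<) (insort x as) (insort b bs)" using Cons.IH[OF s, of x b] Cons.prems 3 by auto
    thus ?thesis using 3 Cons ib by auto
  qed (use Cons s in auto)
qed auto

text \<open>Tested against the Lagrange interpolation polynomial of the point \<open>N j\<close>.\<close>

lemma power_sums_independent:
  fixes c :: "'i \<Rightarrow> 'k :: idom" and N :: "'i \<Rightarrow> 'k"
  assumes "finite I" "inj_on N I" "\<And>s. (\<Sum>i\<in>I. c i * N i ^ s) = 0" "j \<in> I"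
  shows "c j = 0"
proof -
  define P where "P = (\<Prod>i\<in>I - {j}. [:- N i, 1:])"
  have "(\<Sum>i\<in>I. c i * poly p (N i)) = 0" for p :: "'k poly"
  proof -
    have "(\<Sum>i\<in>I. c i * poly p (N i)) = (\<Sum>i\<in>I. \<Sum>s\<le>Polynomial.degree p. coeff p s * (c i * N i ^ s))"
      by (simp add: poly_altdef sum_distrib_left mult_ac)
    also have "\<dots> = (\<Sum>s\<le>Polynomial.degree p. coeff p s * (\<Sum>i\<in>I. c i * N i ^ s))"
      by (subst sum.swap) (simp add: sum_distrib_left)
    finally show ?thesis using assms(3) by simp
  qed
  hence "(\<Sum>i\<in>I. c i * poly P (N i)) = 0" .
  moreover have "poly P (N i) = 0" if "i \<in> I - {j}" for i
    unfolding P_def poly_prod using assms(1) that by (intro prod_zero) auto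
  ultimately have "c j * poly P (N j) = 0"
    using assms(1,4) by (simp add: sum.remove)
  moreover have "poly P (N j) \<noteq> 0"
    unfolding P_def poly_prod using assms by (auto simp: inj_on_def)
  ultimately show ?thesis by simp
qed

section \<open>Hilbert polynomial and degree of the counting function\<close>

lemma Hilbert_polynomial_eqI:
  assumes "\<forall>\<^sub>F k in sequentially. poly P (of_nat k) = of_nat (H k)"
  shows "Hilbert_polynomial H = P"
  unfolding Hilbert_polynomial_def
proof (rule the_equality)
  fix Q :: "rat poly" assume "\<forall>\<^sub>F k in sequentially. poly Q (of_nat k) = of_nat (H k)"
  with assms have "\<forall>\<^sub>F k in sequentially. poly (Q - P) (of_nat k) = 0"
    by eventually_elim simp
  then obtain K where K: "\<And>k. k \<ge> K \<Longrightarrow> poly (Q - P) (of_nat k) = 0"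
    by (auto simp: eventually_sequentially)
  have "infinite (of_nat ` {K..} :: rat set)"
    by (subst finite_image_iff) (auto simp: inj_on_def infinite_Ici)
  moreover have "of_nat ` {K..} \<subseteq> {x. poly (Q - P) x = 0}" using K by auto
  ultimately have "Q - P = 0" using poly_roots_finite[of "Q - P"] finite_subset by blast
  thus "Q = P" by simp
qed (fact assms)

definition binomial_poly :: "nat \<Rightarrow> nat \<Rightarrow> rat poly" where
  "binomial_poly n j = smult (1 / fact j) (\<Prod>i<j. [:of_nat n - of_nat i, 1:])"

lemma poly_binomial_poly: "poly (binomial_poly n j) (of_nat k) = of_nat ((n + k) choose j)"
proof -
  have "of_nat ((n + k) choose j) = (of_nat (n + k) gchoose j :: rat)" by (rule binomial_gbinomial)
  also have "\<dots> = (\<Prod>i<j. of_nat (n + k) - of_nat i) / fact j"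
    by (simp add: gbinomial_prod_rev atLeast0LessThan)
  finally show ?thesis by (simp add: binomial_poly_def poly_prod algebra_simps)
qed

lemma degree_binomial_poly: "Polynomial.degree (binomial_poly n j) = j"
proof -
  have "Polynomial.degree (\<Prod>i<j. [:of_nat n - of_nat i, 1:] :: rat poly) = (\<Sum>i<j. Polynomial.degree [:of_nat n - of_nat i, 1:: rat:])"
    by (rule degree_prod_eq_sum_degree) simp
  thus ?thesis by (simp add: binomial_poly_def)
qed

lemma lead_coeff_binomial_poly: "coeff (binomial_poly n j) j = 1 / fact j"
proof -
  have "lead_coeff (binomial_poly n j) = 1 / fact j"
    by (simp add: binomial_poly_def lead_coeff_smult lead_coeff_prod)
  thus ?thesis by (simp add: degree_binomial_poly)
qed

text \<open>Both products have degree \<open>2 * n\<close> in \<open>k\<close>, with leading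
  coefficients \<open>1 / (n! n!)\<close> and \<open>1 / ((n - 1)! (n + 1)!)\<close>. Their
  difference is \<open>1 / (n! (n + 1)!)\<close>, and \<open>(2 n)!\<close> times this is the
  Catalan number.\<close>

lemma projective_degree_ballot:
  assumes n: "n \<ge> 1"
    and H: "\<And>k. int (H k) = int ((n + k) choose k) * int ((n + k) choose k)
                 - int ((n + k) choose (Suc k)) * int ((n + k) choose (Suc n))"
  shows "projective_degree H = 1 / (of_nat n + 1) * of_nat ((2 * n) choose n)"
proof -
  obtain n' where n': "n = Suc n'" using n by (cases n) auto
  define P where "P = binomial_poly n n * binomial_poly n n - binomial_poly n n' * binomial_poly n (Suc n)"
  have "poly P (of_nat k) = of_nat (H k)" for k
  proof -
    \<comment> \<open>The complementary lower indices \<open>n\<close> and \<open>n' = n - 1\<close>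
      do not depend on \<open>k\<close>, so these factors become polynomials in
      \<open>k\<close>.\<close>
    have c: "n + k choose k = n + k choose n" "n + k choose Suc k = n + k choose n'"
      using binomial_symmetric[of k "n + k"] binomial_symmetric[of n' "n + k"] n' by simp_all
    have "(of_nat (H k) :: rat) = of_int (int (H k))" by simp
    also have "\<dots> = poly P (of_nat k)" unfolding H c P_def by (simp add: poly_binomial_poly)
    finally show ?thesis by simp
  qed
  hence HP: "Hilbert_polynomial H = P" by (intro Hilbert_polynomial_eqI) simp
  have "coeff (binomial_poly n n * binomial_poly n n) (n + n) = 1 / fact n * (1 / fact n)"
    using coeff_mult_degree_sum[of "binomial_poly n n" "binomial_poly n n"]
    by (simp only: degree_binomial_poly lead_coeff_binomial_poly)
  moreover have "coeff (binomial_poly n n' * binomial_poly n (Suc n)) (n' + Suc n) = 1 / fact n' * (1 / fact (Suc n))"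
    using coeff_mult_degree_sum[of "binomial_poly n n'" "binomial_poly n (Suc n)"]
    by (simp only: degree_binomial_poly lead_coeff_binomial_poly)
  ultimately have c: "coeff P (2 * n) = 1 / fact n * (1 / fact n) - 1 / fact n' * (1 / fact (Suc n))"
    unfolding P_def by (simp add: n' mult_2)
  have f: "(fact n :: rat) = of_nat n * fact n'" "(fact (Suc n) :: rat) = (of_nat n + 1) * fact n"
    unfolding n' by (simp_all add: algebra_simps)
  have n1: "of_nat n + 1 \<noteq> (0 :: rat)" using of_nat_neq_0[of n, where 'a = rat] by (simp add: add.commute)
  have c': "coeff P (2 * n) = 1 / (of_nat n + 1) * (1 / (fact n * fact n))"
    unfolding c f using n n1 by (simp add: divide_simps)
  hence "coeff P (2 * n) \<noteq> 0" using n1 by simp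
  moreover have "Polynomial.degree P \<le> 2 * n"
    unfolding P_def
    by (rule degree_diff_le; rule order.trans[OF degree_mult_le]) (auto simp: degree_binomial_poly n')
  ultimately have d: "Polynomial.degree P = 2 * n" using le_degree[of P "2 * n"] by simp
  have "of_nat ((2 * n) choose n) = (fact (2 * n) / (fact n * fact n) :: rat)"
    using binomial_fact[of n "2 * n", where 'a = rat] by simp
  thus ?thesis unfolding projective_degree_def HP Let_def d c' by simp
qed

section \<open>Hilbert functions of associated graded rings\<close>

lemma ideal_ideal_power:
  assumes "cring R" "ideal M R"
  shows "ideal (ideal_power R M k) R"
proof -
  interpret cring R by fact
  show ?thesis
    by (induction k) (simp_all add: oneideal ideal_prod_is_ideal assms)
qed

text \<open>The embedding \<open>\<kappa>\<close> allows independence and spanning to be stated in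
  \<open>R\<close> itself, with coefficients in the field and congruence modulo
  \<open>M\<^sup>k\<^sup>+\<^sup>1\<close>; the quotient ring appears only in the proof. The
  assumption \<open>proper\<close> makes the quotient nontrivial, so that the image of
  \<open>\<kappa>\<close> in it is a subfield.\<close>

lemma gr_Hilbert_function_eqI:
  fixes R :: "('a, 'b) ring_scheme" (structure) and \<kappa> :: "'k :: field \<Rightarrow> 'a"
  assumes R: "cring R" and M: "ideal M R"
    and \<kappa>_carrier: "\<And>c. \<kappa> c \<in> carrier R" and \<kappa>_one: "\<kappa> 1 = \<one>"
    and \<kappa>_add: "\<And>c d. \<kappa> (c + d) = \<kappa> c \<oplus> \<kappa> d" and \<kappa>_mult: "\<And>c d. \<kappa> (c * d) = \<kappa> c \<otimes> \<kappa> d"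
    and us: "set us \<subseteq> ideal_power R M k"
    and ind: "\<And>cs. length cs = length us \<Longrightarrow> ring.combine R (map \<kappa> cs) us \<in> ideal_power R M (Suc k) \<Longrightarrow> set cs \<subseteq> {0}"
    and span: "\<And>x. x \<in> ideal_power R M k \<Longrightarrow>
       \<exists>cs. \<exists>y\<in>ideal_power R M (Suc k). length cs = length us \<and> x = ring.combine R (map \<kappa> cs) us \<oplus> y"
    and proper: "\<one> \<notin> ideal_power R M (Suc k)"
  shows "gr_Hilbert_function R (range \<kappa>) M k = length us"
proof -
  interpret R: cring R by fact
  define J where "J = ideal_power R M (Suc k)"
  interpret J: ideal J R unfolding J_def by (rule ideal_ideal_power[OF R M])
  interpret I: ideal "ideal_power R M k" R by (rule ideal_ideal_power[OF R M])
  define Q where "Q = R Quot J"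
  define h where "h = (\<lambda>x. J +> x)"
  interpret Q: cring Q unfolding Q_def by (rule J.quotient_is_cring[OF R])
  interpret h: ring_hom_ring R Q h
    unfolding h_def Q_def by (rule J.rcos_ring_hom_ring)
  have us_R: "set us \<subseteq> carrier R" using us I.a_subset by blast
  have zeroQ: "\<zero>\<^bsub>Q\<^esub> = J" by (simp add: Q_def FactRing_def)
  have h0: "h x = \<zero>\<^bsub>Q\<^esub> \<longleftrightarrow> x \<in> J" if "x \<in> carrier R" for x
    using that unfolding zeroQ h_def
    by (metis J.a_rcos_const J.a_rcos_self)
  have \<kappa>0: "\<kappa> 0 = \<zero>" using \<kappa>_add[of 0 0] \<kappa>_carrier[of 0] by (simp add: R.add.l_cancel_one)
  have \<kappa>_minus: "\<kappa> (- c) = \<ominus> \<kappa> c" for c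
    using \<kappa>_add[of "- c" c] \<kappa>0 \<kappa>_carrier by (metis R.minus_equality add.commute add.left_inverse)
  have sub: "subfield (h ` range \<kappa>) Q"
  proof (rule Q.subfieldI)
    have "Subrings.subring (h ` range \<kappa>) Q"
    proof (rule Q.subringI)
      show "h ` range \<kappa> \<subseteq> carrier Q" using \<kappa>_carrier by auto
      show "\<one>\<^bsub>Q\<^esub> \<in> h ` range \<kappa>" using \<kappa>_one by (metis h.hom_one rangeI imageI)
      show "\<ominus>\<^bsub>Q\<^esub> x \<in> h ` range \<kappa>" if "x \<in> h ` range \<kappa>" for x
      proof -
        obtain c where "x = h (\<kappa> c)" using \<open>x \<in> _\<close> by auto
        hence "\<ominus>\<^bsub>Q\<^esub> x = h (\<kappa> (- c))" using \<kappa>_carrier by (simp add: \<kappa>_minus)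
        thus ?thesis by blast
      qed
      show "x \<oplus>\<^bsub>Q\<^esub> y \<in> h ` range \<kappa>" "x \<otimes>\<^bsub>Q\<^esub> y \<in> h ` range \<kappa>" if "x \<in> h ` range \<kappa>" "y \<in> h ` range \<kappa>" for x y
      proof -
        obtain c d where "x = h (\<kappa> c)" "y = h (\<kappa> d)" using \<open>x \<in> _\<close> \<open>y \<in> _\<close> by auto
        hence "x \<oplus>\<^bsub>Q\<^esub> y = h (\<kappa> (c + d))" "x \<otimes>\<^bsub>Q\<^esub> y = h (\<kappa> (c * d))" using \<kappa>_carrier by (simp_all add: \<kappa>_add \<kappa>_mult)
        thus "x \<oplus>\<^bsub>Q\<^esub> y \<in> h ` range \<kappa>" "x \<otimes>\<^bsub>Q\<^esub> y \<in> h ` range \<kappa>" by blast+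
      qed
    qed
    thus "subcring (h ` range \<kappa>) Q" by (rule Q.subcringI')
    have one_ne: "\<one>\<^bsub>Q\<^esub> \<noteq> \<zero>\<^bsub>Q\<^esub>"
      using proper h0[of \<one>] unfolding J_def[symmetric] by simp
    have inv: "h (\<kappa> c) \<otimes>\<^bsub>Q\<^esub> h (\<kappa> (inverse c)) = \<one>\<^bsub>Q\<^esub>" if "c \<noteq> 0" for c
    proof -
      have "h (\<kappa> c) \<otimes>\<^bsub>Q\<^esub> h (\<kappa> (inverse c)) = h (\<kappa> (c * inverse c))"
        using \<kappa>_carrier by (simp add: \<kappa>_mult)
      thus ?thesis using that \<kappa>_one by simp
    qed
    show "Units (Q\<lparr>carrier := h ` range \<kappa>\<rparr>) = h ` range \<kappa> - {\<zero>\<^bsub>Q\<^esub>}"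
    proof (intro equalityI subsetI)
      fix x assume x: "x \<in> Units (Q\<lparr>carrier := h ` range \<kappa>\<rparr>)"
      then obtain y where "x \<in> h ` range \<kappa>" "y \<in> h ` range \<kappa>" "y \<otimes>\<^bsub>Q\<^esub> x = \<one>\<^bsub>Q\<^esub>"
        by (auto simp: Units_def)
      moreover have "y \<in> carrier Q" using \<open>y \<in> h ` range \<kappa>\<close> \<kappa>_carrier by auto
      ultimately show "x \<in> h ` range \<kappa> - {\<zero>\<^bsub>Q\<^esub>}" using one_ne by auto
    next
      fix x assume "x \<in> h ` range \<kappa> - {\<zero>\<^bsub>Q\<^esub>}"
      then obtain c where c: "x = h (\<kappa> c)" "x \<noteq> \<zero>\<^bsub>Q\<^esub>" by auto
      have "c \<noteq> 0" using c \<kappa>0 by auto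
      from inv[OF this] have "x \<otimes>\<^bsub>Q\<^esub> h (\<kappa> (inverse c)) = \<one>\<^bsub>Q\<^esub>" "h (\<kappa> (inverse c)) \<otimes>\<^bsub>Q\<^esub> x = \<one>\<^bsub>Q\<^esub>"
        using c \<kappa>_carrier Q.m_comm by auto
      thus "x \<in> Units (Q\<lparr>carrier := h ` range \<kappa>\<rparr>)" unfolding Units_def using c by auto
    qed
  qed
  have hcomb: "Q.combine (map (\<lambda>c. h (\<kappa> c)) cs) (map h us') = h (R.combine (map \<kappa> cs) us')"
    if "set us' \<subseteq> carrier R" for cs us'
    using that
  proof (induction cs arbitrary: us')
    case (Cons c cs)
    show ?case
    proof (cases us')
      case (Cons u us'')
      have "R.combine (map \<kappa> cs) us'' \<in> carrier R"
        using Cons.prems Cons \<kappa>_carrier by (intro R.combine_in_carrier) auto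
      thus ?thesis using Cons.IH[of us''] Cons.prems Cons \<kappa>_carrier by simp
    qed simp
  qed simp
  have hus: "set (map h us) \<subseteq> carrier Q" using us_R by auto
  have indep: "Q.independent (h ` range \<kappa>) (map h us)"
  proof (rule Q.trivial_combine_imp_independent[OF sub hus])
    fix Ks assume Ks: "set Ks \<subseteq> h ` range \<kappa>" "Q.combine Ks (map h us) = \<zero>\<^bsub>Q\<^esub>"
    \<comment> \<open>\<open>combine\<close> ignores surplus coefficients and reads missing ones as
      zero, so \<open>Ks\<close> can have any length; it is cut or padded to the length of
      \<open>us\<close>.\<close>
    define Ks' where "Ks' = take (length us) Ks @ replicate (length us - length Ks) \<zero>\<^bsub>Q\<^esub>"
    have z: "\<zero>\<^bsub>Q\<^esub> \<in> h ` range \<kappa>" using \<kappa>0 by (metis h.hom_zero rangeI imageI)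
    have Ks': "set Ks' \<subseteq> h ` range \<kappa>" "length Ks' = length us"
      using Ks(1) z unfolding Ks'_def by (auto dest: in_set_takeD)
    have "Q.combine Ks' (map h us) = Q.combine (take (length us) Ks) (map h us)"
      unfolding Ks'_def by (rule Q.combine_append_replicate[OF hus])
    also have "\<dots> = \<zero>\<^bsub>Q\<^esub>" using Q.combine_take[of "map h us" Ks] Ks(2) by simp
    finally have 0: "Q.combine Ks' (map h us) = \<zero>\<^bsub>Q\<^esub>" .
    have "\<exists>cs. Ks' = map (\<lambda>c. h (\<kappa> c)) cs"
      unfolding ex_map_conv using Ks'(1) by blast
    then obtain cs where cs: "Ks' = map (\<lambda>c. h (\<kappa> c)) cs" ..
    have "R.combine (map \<kappa> cs) us \<in> carrier R" using us_R \<kappa>_carrier by (intro R.combine_in_carrier) auto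
    moreover have "h (R.combine (map \<kappa> cs) us) = \<zero>\<^bsub>Q\<^esub>" using hcomb[OF us_R, of cs] 0 cs by simp
    ultimately have "R.combine (map \<kappa> cs) us \<in> J" using h0 by blast
    hence "set cs \<subseteq> {0}" using ind[of cs] Ks'(2) cs by (simp add: J_def)
    hence "set Ks' \<subseteq> {\<zero>\<^bsub>Q\<^esub>}" unfolding cs using \<kappa>0 by auto
    thus "set (take (length (map h us)) Ks) \<subseteq> {\<zero>\<^bsub>Q\<^esub>}" by (simp add: Ks'_def)
  qed
  have spn: "Q.Span (h ` range \<kappa>) (map h us) = h ` ideal_power R M k"
  proof
    show "Q.Span (h ` range \<kappa>) (map h us) \<subseteq> h ` ideal_power R M k"
    proof
      fix x assume "x \<in> Q.Span (h ` range \<kappa>) (map h us)"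
      then obtain Ks where Ks: "set Ks \<subseteq> h ` range \<kappa>" "x = Q.combine Ks (map h us)"
        using Q.Span_mem_iff_length_version[OF sub hus] by blast
      have "\<exists>cs. Ks = map (\<lambda>c. h (\<kappa> c)) cs"
        unfolding ex_map_conv using Ks(1) by blast
      then obtain cs where cs: "Ks = map (\<lambda>c. h (\<kappa> c)) cs" ..
      have "R.combine (map \<kappa> cs) us' \<in> ideal_power R M k" if "set us' \<subseteq> ideal_power R M k" for us'
        using that
      proof (induction cs arbitrary: us')
        case (Cons c cs)
        show ?case
        proof (cases us')
          case (Cons u us'')
          thus ?thesis using Cons.IH[of us''] Cons.prems \<kappa>_carrier
            by (auto intro!: I.a_closed I.I_l_closed)
        qed (simp add: I.zero_closed)
      qed (simp add: I.zero_closed)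
      from this[OF us] show "x \<in> h ` ideal_power R M k" unfolding Ks(2) cs hcomb[OF us_R] by blast
    qed
    show "h ` ideal_power R M k \<subseteq> Q.Span (h ` range \<kappa>) (map h us)"
    proof
      fix z assume "z \<in> h ` ideal_power R M k"
      then obtain x where x: "x \<in> ideal_power R M k" "z = h x" by blast
      obtain cs y where c: "y \<in> J" "length cs = length us" "x = R.combine (map \<kappa> cs) us \<oplus> y"
        using span[OF x(1)] unfolding J_def by blast
      have "R.combine (map \<kappa> cs) us \<in> carrier R" using us_R \<kappa>_carrier by (intro R.combine_in_carrier) auto
      hence "h x = h (R.combine (map \<kappa> cs) us) \<oplus>\<^bsub>Q\<^esub> h y" using c J.a_subset by auto
      also have "h y = \<zero>\<^bsub>Q\<^esub>" using c(1) h0 J.a_subset by blast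
      also have "h (R.combine (map \<kappa> cs) us) \<oplus>\<^bsub>Q\<^esub> \<zero>\<^bsub>Q\<^esub> = Q.combine (map (\<lambda>c. h (\<kappa> c)) cs) (map h us)"
        using \<open>R.combine (map \<kappa> cs) us \<in> carrier R\<close> by (simp add: hcomb[OF us_R])
      finally show "z \<in> Q.Span (h ` range \<kappa>) (map h us)"
        using Q.Span_mem_iff_length_version[OF sub hus] x(2) c(2)
        by (auto intro!: exI[of _ "map (\<lambda>c. h (\<kappa> c)) cs"])
    qed
  qed
  have "Q.dimension (length us) (h ` range \<kappa>) (h ` ideal_power R M k)"
    using Q.dimension_independent[OF indep] spn by simp
  hence "Q.dim (h ` range \<kappa>) (h ` ideal_power R M k) = length us"
    using Q.dimI[OF sub] by (simp add: over_def)
  thus ?thesis unfolding gr_Hilbert_function_def Let_def J_def[symmetric] Q_def h_def .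
qed

section \<open>Regular functions on the flag variety\<close>

lemma openin_GL_basic: "a \<in> poly_funs m \<Longrightarrow> openin (GL_top m) {g \<in> GL m. a g \<noteq> 0}"
  unfolding GL_top_def by (rule topology_generated_by_Basis) blast

text \<open>The generating sets form a base and not only a subbase, since
  \<open>{a \<noteq> 0}\<close> and \<open>{b \<noteq> 0}\<close> intersect in
  \<open>{a * b \<noteq> 0}\<close>.\<close>

lemma openin_GL_topE:
  assumes "openin (GL_top m) W" "g \<in> W"
  obtains a where "a \<in> poly_funs m" "a g \<noteq> 0" "{x \<in> GL m. a x \<noteq> 0} \<subseteq> W"
proof -
  have "generate_topology_on {{g \<in> GL m. a g \<noteq> 0} |a. a \<in> poly_funs m} W"
    using assms(1) unfolding GL_top_def by (simp add: openin_topology_generated_by)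
  hence "g \<in> W \<Longrightarrow> \<exists>a\<in>poly_funs m. a g \<noteq> 0 \<and> {x \<in> GL m. a x \<noteq> 0} \<subseteq> W"
  proof (induction rule: generate_topology_on.induct)
    case (Int V W)
    then obtain a b where "a \<in> poly_funs m" "a g \<noteq> 0" "{x \<in> GL m. a x \<noteq> 0} \<subseteq> V"
      "b \<in> poly_funs m" "b g \<noteq> 0" "{x \<in> GL m. b x \<noteq> 0} \<subseteq> W" by blast
    thus ?case by (intro bexI[of _ "\<lambda>x. a x * b x"] poly_funs.mult) auto
  next
    case (UN K)
    then obtain k where k: "k \<in> K" "g \<in> k" by blast
    from UN.IH[OF k] k(1) show ?case by blast
  next
    case (Basis W)
    thus ?case by blast
  qed simp
  thus ?thesis using that assms(2) by blast
qed

lemma regular_on_flagsE: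
  assumes "regular_on_flags m U h" "g \<in> GL m" "flag_point m g \<in> U"
  obtains a b W where "a \<in> poly_funs m" "b \<in> poly_funs m" "openin (GL_top m) W" "g \<in> W"
    "\<And>x. x \<in> W \<Longrightarrow> x \<in> GL m \<and> flag_point m x \<in> U \<and> b x \<noteq> 0 \<and> h (flag_point m x) = a x / b x"
proof -
  have "g \<in> {g \<in> GL m. flag_point m g \<in> U}" using assms by simp
  with assms(1) obtain a b W where "a \<in> poly_funs m" "b \<in> poly_funs m" "openin (GL_top m) W" "g \<in> W"
    "W \<subseteq> {g \<in> GL m. flag_point m g \<in> U}" "\<forall>x\<in>W. b x \<noteq> 0 \<and> h (flag_point m x) = a x / b x"
    unfolding regular_on_flags_def regular_on_GL_def by blast
  thus ?thesis using that by blast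
qed

lemma regular_on_flagsI:
  assumes "\<And>g. g \<in> GL m \<Longrightarrow> flag_point m g \<in> U \<Longrightarrow> \<exists>a\<in>poly_funs m. \<exists>b\<in>poly_funs m. \<exists>W. openin (GL_top m) W \<and> g \<in> W \<and>
     (\<forall>x\<in>W. x \<in> GL m \<and> flag_point m x \<in> U \<and> b x \<noteq> 0 \<and> h (flag_point m x) = a x / b x)"
  shows "regular_on_flags m U h"
  unfolding regular_on_flags_def regular_on_GL_def
proof
  fix g assume "g \<in> {g \<in> GL m. flag_point m g \<in> U}"
  then obtain a b W where "a\<in>poly_funs m" "b\<in>poly_funs m" "openin (GL_top m) W" "g \<in> W"
     "\<forall>x\<in>W. x \<in> GL m \<and> flag_point m x \<in> U \<and> b x \<noteq> 0 \<and> h (flag_point m x) = a x / b x"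
    using assms[of g] by blast
  thus "\<exists>a\<in>poly_funs m. \<exists>b\<in>poly_funs m. \<exists>W. openin (GL_top m) W \<and> g \<in> W \<and>
      W \<subseteq> {g \<in> GL m. flag_point m g \<in> U} \<and> (\<forall>x\<in>W. b x \<noteq> 0 \<and> h (flag_point m x) = a x / b x)"
    by (intro bexI[of _ a] bexI[of _ b] exI[of _ W]) auto
qed

text \<open>Near each point the zeros of \<open>h\<close> are those of a numerator. This serves both
  to extend identities from the orbit to its closure and to invert germs.\<close>

lemma openin_flag_nonvanishing:
  assumes "regular_on_flags m U h" "U \<subseteq> flags m"
  shows "openin (flag_top m) {x \<in> U. h x \<noteq> 0}"
  unfolding openin_flag_top
proof
  show "{x \<in> U. h x \<noteq> 0} \<subseteq> flags m" using assms(2) by blast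
  show "openin (GL_top m) {g \<in> GL m. flag_point m g \<in> {x \<in> U. h x \<noteq> 0}}"
  proof (subst openin_subopen, safe)
    fix g assume g: "g \<in> GL m" "flag_point m g \<in> U" "h (flag_point m g) \<noteq> 0"
    obtain a b W where W: "a \<in> poly_funs m" "b \<in> poly_funs m" "openin (GL_top m) W" "g \<in> W"
      "\<And>x. x \<in> W \<Longrightarrow> x \<in> GL m \<and> flag_point m x \<in> U \<and> b x \<noteq> 0 \<and> h (flag_point m x) = a x / b x"
      using regular_on_flagsE[OF assms(1) g(1,2)] by metis
    have "openin (GL_top m) (W \<inter> {x \<in> GL m. a x \<noteq> 0})" using W openin_GL_basic by blast
    moreover have "g \<in> W \<inter> {x \<in> GL m. a x \<noteq> 0}" using W(4) W(5)[OF W(4)] g by auto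
    moreover have "W \<inter> {x \<in> GL m. a x \<noteq> 0} \<subseteq> {g \<in> GL m. flag_point m g \<in> {x \<in> U. h x \<noteq> 0}}"
      using W(5) by auto
    ultimately show "\<exists>T. openin (GL_top m) T \<and> g \<in> T \<and> T \<subseteq> {g \<in> GL m. flag_point m g \<in> {x \<in> U. h x \<noteq> 0}}"
      by blast
  qed
qed

lemma regular_on_flags_inverse:
  assumes "regular_on_flags m U h"
  shows "regular_on_flags m {x \<in> U. h x \<noteq> 0} (\<lambda>x. 1 / h x)"
proof (rule regular_on_flagsI)
  fix g assume g: "g \<in> GL m" "flag_point m g \<in> {x \<in> U. h x \<noteq> 0}"
  then obtain a b W where W: "a \<in> poly_funs m" "b \<in> poly_funs m" "openin (GL_top m) W" "g \<in> W"
    "\<And>x. x \<in> W \<Longrightarrow> x \<in> GL m \<and> flag_point m x \<in> U \<and> b x \<noteq> 0 \<and> h (flag_point m x) = a x / b x"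
    using regular_on_flagsE[OF assms g(1)] by (metis (lifting) mem_Collect_eq)
  have "openin (GL_top m) (W \<inter> {x \<in> GL m. a x \<noteq> 0})" using W openin_GL_basic by blast
  moreover have "g \<in> W \<inter> {x \<in> GL m. a x \<noteq> 0}" using W(4) W(5)[OF W(4)] g by auto
  ultimately show "\<exists>a\<in>poly_funs m. \<exists>b\<in>poly_funs m. \<exists>W. openin (GL_top m) W \<and> g \<in> W \<and>
     (\<forall>x\<in>W. x \<in> GL m \<and> flag_point m x \<in> {x \<in> U. h x \<noteq> 0} \<and> b x \<noteq> 0 \<and> 1 / h (flag_point m x) = a x / b x)"
    using W by (intro bexI[of _ b] bexI[of _ a] exI[of _ "W \<inter> {x \<in> GL m. a x \<noteq> 0}"]) auto
qed

lemma regular_near_inverse: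
  assumes "f \<in> regular_near m X p" "f p \<noteq> 0" "p \<in> X" "X \<subseteq> flags m"
  shows "(\<lambda>x. 1 / f x) \<in> regular_near m X p"
proof -
  obtain U h where U: "openin (flag_top m) U" "p \<in> U" "regular_on_flags m U h" "\<forall>x\<in>X \<inter> U. f x = h x"
    using assms(1) unfolding regular_near_def by blast
  have "U \<subseteq> flags m" using U(1) by (simp add: openin_flag_top)
  hence "openin (flag_top m) {x \<in> U. h x \<noteq> 0}" by (rule openin_flag_nonvanishing[OF U(3)])
  moreover have "p \<in> {x \<in> U. h x \<noteq> 0}" using U assms by auto
  ultimately show ?thesis
    unfolding regular_near_def using U regular_on_flags_inverse[OF U(3)] by fastforce
qed

section \<open>Polynomial functions, the Borel subgroup and its cosets\<close>

lemma poly_funs_sum: "(\<And>i. i \<in> I \<Longrightarrow> f i \<in> poly_funs m) \<Longrightarrow> (\<lambda>g. \<Sum>i\<in>I. f i g) \<in> poly_funs m"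
  by (induction I rule: infinite_finite_induct) (auto intro: poly_funs.intros)

lemma poly_funs_prod: "(\<And>i. i \<in> I \<Longrightarrow> f i \<in> poly_funs m) \<Longrightarrow> (\<lambda>g. \<Prod>i\<in>I. f i g) \<in> poly_funs m"
  by (induction I rule: infinite_finite_induct) (auto intro: poly_funs.intros)

lemma GL_carrier: "g \<in> GL m \<Longrightarrow> g \<in> carrier_mat m m"
  by (simp add: GL_def)

lemma Borel_carrier: "b \<in> Borel m \<Longrightarrow> b \<in> carrier_mat m m"
  by (simp add: Borel_def GL_def)

lemma GL_iff_det: "g \<in> GL m \<longleftrightarrow> g \<in> carrier_mat m m \<and> det g \<noteq> 0"
proof
  assume "g \<in> GL m"
  then obtain g' where "g' \<in> carrier_mat m m" "g * g' = 1\<^sub>m m" by (rule GL_inverseE)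
  with \<open>g \<in> GL m\<close> have "det g * det g' = 1" using det_mult[of g m g'] by (simp add: GL_carrier)
  thus "g \<in> carrier_mat m m \<and> det g \<noteq> 0" using \<open>g \<in> GL m\<close> by (auto simp: GL_carrier)
next
  assume g: "g \<in> carrier_mat m m \<and> det g \<noteq> 0"
  hence "g \<in> Units (ring_mat TYPE(complex) m ())" by (simp add: det_non_zero_imp_unit)
  thus "g \<in> GL m" using g unfolding Units_def ring_mat_def by (auto intro: GL_I)
qed

lemma Borel_iff:
  "b \<in> Borel m \<longleftrightarrow> b \<in> carrier_mat m m \<and> upper_triangular b \<and> (\<forall>i<m. b $$ (i, i) \<noteq> 0)"
proof -
  have "det b \<noteq> 0 \<longleftrightarrow> (\<forall>i<m. b $$ (i, i) \<noteq> 0)" if "b \<in> carrier_mat m m" "upper_triangular b"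
    using upper_triangular_imp_det_eq_0_iff[OF that] that(1) by (auto simp: diag_mat_def)
  thus ?thesis by (auto simp: Borel_def GL_iff_det)
qed

lemma Borel_zero: "b \<in> Borel m \<Longrightarrow> i < m \<Longrightarrow> j < i \<Longrightarrow> b $$ (i, j) = 0"
  by (auto simp: Borel_iff upper_triangular_def)

lemma mat_mult_entry:
  "A \<in> carrier_mat k l \<Longrightarrow> B \<in> carrier_mat l r \<Longrightarrow> i < k \<Longrightarrow> j < r \<Longrightarrow>
     (A * B) $$ (i, j) = (\<Sum>h<l. A $$ (i, h) * B $$ (h, j))"
  by (auto simp: scalar_prod_def atLeast0LessThan)

lemma Borel_left_inverse:
  assumes b: "b \<in> Borel m" and b': "b' \<in> carrier_mat m m" "b' * b = 1\<^sub>m m"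
  shows "b' \<in> Borel m"
proof -
  have bc: "b \<in> carrier_mat m m" using b by (rule Borel_carrier)
  have "b' $$ (i, j) = 0" if "i < m" "j < i" for i j
    using that
  proof (induction j rule: less_induct)
    case (less j)
    have "0 = (b' * b) $$ (i, j)" using less.prems by (simp add: b'(2))
    also have "\<dots> = (\<Sum>h<m. b' $$ (i, h) * b $$ (h, j))"
      using less.prems by (intro mat_mult_entry[OF b'(1) bc]) auto
    \<comment> \<open>The terms with \<open>h < j\<close> vanish by induction on the column, those
      with \<open>h > j\<close> because \<open>b\<close> is upper triangular.\<close>
    also have "\<dots> = (\<Sum>h<m. if h = j then b' $$ (i, j) * b $$ (j, j) else 0)"
    proof (intro sum.cong refl)
      fix h assume "h \<in> {..<m}"
      thus "b' $$ (i, h) * b $$ (h, j) = (if h = j then b' $$ (i, j) * b $$ (j, j) else 0)"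
        using less Borel_zero[OF b, of h j] by (cases h j rule: linorder_cases) auto
    qed
    also have "\<dots> = b' $$ (i, j) * b $$ (j, j)" using less.prems by (simp add: sum.delta)
    finally show ?case using b less.prems by (auto simp: Borel_iff)
  qed
  hence "upper_triangular b'" using b'(1) by (auto simp: upper_triangular_def)
  moreover have "b' \<in> GL m"
    using GL_I[OF b'(1) bc b'(2) mat_mult_left_right_inverse[OF b'(1) bc b'(2)]] .
  ultimately show ?thesis by (simp add: Borel_def)
qed

lemma flag_point_mult_Borel:
  assumes g: "g \<in> carrier_mat m m" and b: "b \<in> Borel m"
  shows "flag_point m (g * b) = flag_point m g"
proof -
  have sub: "flag_point m (g * b) \<subseteq> flag_point m g" if "g \<in> carrier_mat m m" "b \<in> Borel m" for g b
  proof
    fix x assume "x \<in> flag_point m (g * b)"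
    then obtain c where c: "c \<in> Borel m" "x = g * b * c" by (auto simp: flag_point_def)
    hence "x = g * (b * c)" using assoc_mult_mat[OF that(1) Borel_carrier[OF that(2)] Borel_carrier[OF c(1)]] by simp
    thus "x \<in> flag_point m g" using Borel_mult_closed[OF that(2) c(1)] by (auto simp: flag_point_def)
  qed
  have bc: "b \<in> carrier_mat m m" using b by (rule Borel_carrier)
  obtain b' where b': "b' \<in> carrier_mat m m" "b * b' = 1\<^sub>m m" "b' * b = 1\<^sub>m m"
    using b GL_inverseE[of b m] by (auto simp: Borel_def)
  have "b' \<in> Borel m" by (rule Borel_left_inverse[OF b b'(1,3)])
  moreover have "g * b * b' = g" using assoc_mult_mat[OF g bc b'(1)] g b'(2) by simp
  ultimately have "flag_point m g \<subseteq> flag_point m (g * b)"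
    using sub[of "g * b" b'] g bc by simp
  thus ?thesis using sub[OF g b] by simp
qed

lemma flag_point_eqE:
  assumes "g \<in> GL m" "h \<in> GL m" "flag_point m g = flag_point m h"
  obtains b where "b \<in> Borel m" "h = g * b"
proof -
  have "h * 1\<^sub>m m \<in> flag_point m h" unfolding flag_point_def using one_in_Borel by blast
  hence "h \<in> flag_point m g" using assms(3) right_mult_one_mat[OF GL_carrier[OF assms(2)]] by simp
  thus ?thesis using that by (auto simp: flag_point_def)
qed

section \<open>Minors of the first columns\<close>

definition minor_mat :: "nat \<Rightarrow> nat \<Rightarrow> complex mat \<Rightarrow> complex mat" where
  "minor_mat r c g = mat (Suc c) (Suc c) (\<lambda>(i, j). g $$ (if i = c then r else i, j))"

text \<open>A Pluecker coordinate of the span of the first \<open>c + 1\<close> columns: rows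
  \<open>0..c - 1\<close> and \<open>r\<close> are used. For \<open>r = c\<close> it is the leading
  principal minor.\<close>

definition flag_minor :: "nat \<Rightarrow> nat \<Rightarrow> complex mat \<Rightarrow> complex" where
  "flag_minor r c g = det (minor_mat r c g)"

lemma minor_mat_carrier [simp]: "minor_mat r c g \<in> carrier_mat (Suc c) (Suc c)"
  by (simp add: minor_mat_def)

lemma flag_minor_poly:
  assumes "r < m" "c < m"
  shows "flag_minor r c \<in> poly_funs m"
proof -
  have "flag_minor r c = (\<lambda>g. \<Sum>p | p permutes {0..<Suc c}. signof p *
     (\<Prod>i=0..<Suc c. g $$ (if i = c then r else i, p i)))"
    unfolding flag_minor_def det_def'[OF minor_mat_carrier]
  proof (intro ext sum.cong refl arg_cong2[of _ _ _ _ "(*)"] prod.cong)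
    fix g p i assume p: "p \<in> {p. p permutes {0..<Suc c}}" and i: "i \<in> {0..<Suc c}"
    have "p i \<in> {0..<Suc c}" using p i by (simp only: mem_Collect_eq permutes_in_image)
    thus "minor_mat r c g $$ (i, p i) = g $$ (if i = c then r else i, p i)"
      using i by (simp add: minor_mat_def)
  qed
  also have "\<dots> \<in> poly_funs m"
  proof (intro poly_funs_sum poly_funs.mult poly_funs.const poly_funs_prod)
    fix p i assume p: "p \<in> {p. p permutes {0..<Suc c}}" and i: "i \<in> {0..<Suc c}"
    have "p i \<in> {0..<Suc c}" using p i by (simp only: mem_Collect_eq permutes_in_image)
    thus "(\<lambda>g. g $$ (if i = c then r else i, p i)) \<in> poly_funs m"
      using assms i by (intro poly_funs.entry) auto
  qed
  finally show ?thesis .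
qed

text \<open>The first \<open>c + 1\<close> columns of \<open>g * b\<close> are combinations of the
  first \<open>c + 1\<close> columns of \<open>g\<close>, with coefficients from the leading block
  of \<open>b\<close>. The scaling factor does not depend on \<open>r\<close>, so quotients of
  minors with the same \<open>c\<close> are functions on flags.\<close>

lemma flag_minor_mult_Borel:
  assumes g: "g \<in> carrier_mat m m" and b: "b \<in> Borel m" and r: "r < m" and c: "c < m"
  shows "flag_minor r c (g * b) = flag_minor r c g * flag_minor c c b"
proof -
  have bc: "b \<in> carrier_mat m m" using b by (rule Borel_carrier)
  have "minor_mat r c (g * b) = minor_mat r c g * minor_mat c c b"
  proof (rule eq_matI)
    fix i j assume "i < dim_row (minor_mat r c g * minor_mat c c b)" "j < dim_col (minor_mat r c g * minor_mat c c b)"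
    hence ij: "i < Suc c" "j < Suc c" by (auto simp: minor_mat_def)
    define i' where "i' = (if i = c then r else i)"
    have "i' < m" "j < m" using ij r c by (auto simp: i'_def)
    have "minor_mat r c (g * b) $$ (i, j) = (g * b) $$ (i', j)"
      using ij by (simp add: minor_mat_def i'_def)
    also have "\<dots> = (\<Sum>h<m. g $$ (i', h) * b $$ (h, j))"
      by (rule mat_mult_entry[OF g bc \<open>i' < m\<close> \<open>j < m\<close>])
    also have "\<dots> = (\<Sum>h<Suc c. g $$ (i', h) * b $$ (h, j))"
      using c ij Borel_zero[OF b] by (intro sum.mono_neutral_right) auto
    also have "\<dots> = (\<Sum>h<Suc c. minor_mat r c g $$ (i, h) * minor_mat c c b $$ (h, j))"
      using ij by (intro sum.cong) (auto simp: minor_mat_def i'_def)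
    also have "\<dots> = (minor_mat r c g * minor_mat c c b) $$ (i, j)"
      using ij by (intro mat_mult_entry[symmetric]) auto
    finally show "minor_mat r c (g * b) $$ (i, j) = (minor_mat r c g * minor_mat c c b) $$ (i, j)" .
  qed (auto simp: minor_mat_def)
  thus ?thesis unfolding flag_minor_def by (simp add: det_mult[OF minor_mat_carrier minor_mat_carrier])
qed

lemma flag_minor_Borel_nonzero:
  assumes b: "b \<in> Borel m" and c: "c < m"
  shows "flag_minor c c b \<noteq> 0"
proof -
  have "minor_mat c c b \<in> Borel (Suc c)"
    using b c Borel_zero[OF b] by (auto simp: Borel_iff minor_mat_def upper_triangular_def)
  thus ?thesis unfolding flag_minor_def by (auto simp: Borel_def GL_iff_det)
qed

lemma flag_minor_eq_0:
  assumes "r < c"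
  shows "flag_minor r c g = 0"
  unfolding flag_minor_def
  using assms
  by (intro det_identical_rows[of _ "Suc c" r c]) (auto simp: minor_mat_def intro!: eq_vecI)

lemma flag_minor_unitriangular:
  assumes "\<And>i j. i < j \<Longrightarrow> j < m \<Longrightarrow> g $$ (i, j) = 0" "\<And>i. i < m \<Longrightarrow> g $$ (i, i) = 1"
    "c \<le> r" "r < m"
  shows "flag_minor r c g = g $$ (r, c)"
proof -
  have "det (minor_mat r c g) = prod_list (diag_mat (minor_mat r c g))"
    using assms by (intro det_lower_triangular[of "Suc c"]) (auto simp: minor_mat_def)
  also have "\<dots> = (\<Prod>i=0..<Suc c. if i = c then g $$ (r, c) else 1)"
    unfolding prod_list_diag_prod using assms by (intro prod.cong) (auto simp: minor_mat_def)
  finally show ?thesis by (simp add: flag_minor_def)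
qed

text \<open>The cofactors along the last row do not depend on that row.\<close>

lemma flag_minor_expand:
  "flag_minor r c g = (\<Sum>j<Suc c. g $$ (r, j) * cofactor (minor_mat c c g) c j)"
proof -
  have "mat_delete (minor_mat r c g) c j = mat_delete (minor_mat c c g) c j" for j
    by (rule eq_matI) (auto simp: mat_delete_def minor_mat_def)
  hence "cofactor (minor_mat r c g) c j = cofactor (minor_mat c c g) c j" for j
    by (simp add: cofactor_def)
  hence "flag_minor r c g = (\<Sum>j<Suc c. minor_mat r c g $$ (c, j) * cofactor (minor_mat c c g) c j)"
    unfolding flag_minor_def by (subst laplace_expansion_row[OF minor_mat_carrier, of c]) auto
  thus ?thesis by (simp add: minor_mat_def)
qed

lemma cofactor_minor_mat_last:
  "cofactor (minor_mat c c g) c c = (if c = 0 then 1 else flag_minor (c - 1) (c - 1) g)"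
proof (cases c)
  case 0
  have "mat_delete (minor_mat 0 0 g) 0 0 \<in> carrier_mat 0 0"
    by (auto simp: mat_delete_def minor_mat_def)
  thus ?thesis using 0 by (simp add: cofactor_def)
next
  case (Suc d)
  have "mat_delete (minor_mat c c g) c c = minor_mat d d g"
    using Suc by (intro eq_matI) (auto simp: mat_delete_def minor_mat_def)
  moreover have "(- 1) ^ (c + c) = (1 :: complex)" by (metis even_add neg_one_even_power)
  ultimately show ?thesis using Suc by (simp add: cofactor_def flag_minor_def)
qed

section \<open>Coordinates on the big cell\<close>

text \<open>The choice of the representative is immaterial by \<open>coord_flag_point\<close>. Where
  the principal minor vanishes, off the big cell, the value is 0 by the convention for
  division.\<close>

definition coord :: "nat \<Rightarrow> nat \<Rightarrow> nat \<Rightarrow> complex mat set \<Rightarrow> complex" where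
  "coord m r c F =
     (let g = SOME g. g \<in> GL m \<and> flag_point m g = F in flag_minor r c g / flag_minor c c g)"

definition big_cell :: "nat \<Rightarrow> complex mat set set" where
  "big_cell m = {flag_point m g |g. g \<in> GL m \<and> (\<forall>c<m. flag_minor c c g \<noteq> 0)}"

definition chart :: "nat \<Rightarrow> complex mat set \<Rightarrow> complex mat" where
  "chart m F = mat m m (\<lambda>(r, c). coord m r c F)"

lemma coord_flag_point:
  assumes "g \<in> GL m" "r < m" "c < m"
  shows "coord m r c (flag_point m g) = flag_minor r c g / flag_minor c c g"
proof -
  define h where "h = (SOME h. h \<in> GL m \<and> flag_point m h = flag_point m g)"
  have "h \<in> GL m \<and> flag_point m h = flag_point m g"
    unfolding h_def by (rule someI[of _ g]) (simp add: assms)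
  then obtain b where b: "b \<in> Borel m" "g = h * b" and h: "h \<in> GL m"
    using flag_point_eqE[of h m g] assms(1) by metis
  have "flag_minor r c g / flag_minor c c g = flag_minor r c h / flag_minor c c h"
    unfolding b(2) using assms flag_minor_Borel_nonzero[OF b(1)]
    by (simp add: flag_minor_mult_Borel[OF GL_carrier[OF h] b(1)])
  thus ?thesis unfolding coord_def Let_def h_def by simp
qed

lemma flag_point_in_big_cell_iff:
  assumes "g \<in> GL m"
  shows "flag_point m g \<in> big_cell m \<longleftrightarrow> (\<forall>c<m. flag_minor c c g \<noteq> 0)"
proof
  assume "flag_point m g \<in> big_cell m"
  then obtain h where h: "h \<in> GL m" "\<forall>c<m. flag_minor c c h \<noteq> 0" "flag_point m h = flag_point m g"
    by (auto simp: big_cell_def)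
  then obtain b where b: "b \<in> Borel m" "g = h * b" using flag_point_eqE[of h m g] assms by metis
  thus "\<forall>c<m. flag_minor c c g \<noteq> 0"
    unfolding b(2) using h(2) by (simp add: flag_minor_mult_Borel[OF GL_carrier[OF h(1)] b(1)] flag_minor_Borel_nonzero)
qed (use assms in \<open>auto simp: big_cell_def\<close>)

lemma big_cell_subset: "big_cell m \<subseteq> flags m"
  by (auto simp: big_cell_def flags_def)

lemma openin_GL_big_cell: "openin (GL_top m) {g \<in> GL m. flag_point m g \<in> big_cell m}"
proof -
  have *: "{g \<in> GL m. flag_point m g \<in> big_cell m} = {g \<in> GL m. (\<Prod>c<m. flag_minor c c g) \<noteq> 0}"
    by (auto simp: flag_point_in_big_cell_iff)
  have "(\<lambda>g. \<Prod>c<m. flag_minor c c g) \<in> poly_funs m"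
    by (intro poly_funs_prod flag_minor_poly) auto
  from openin_GL_basic[OF this] show ?thesis by (simp only: *)
qed

lemma openin_big_cell: "openin (flag_top m) (big_cell m)"
  unfolding openin_flag_top using openin_GL_big_cell big_cell_subset by blast

lemma coord_big_cell_diag: "F \<in> big_cell m \<Longrightarrow> c < m \<Longrightarrow> coord m c c F = 1"
  by (auto simp: big_cell_def coord_flag_point)

lemma coord_big_cell_upper: "F \<in> big_cell m \<Longrightarrow> r < c \<Longrightarrow> c < m \<Longrightarrow> coord m r c F = 0"
  by (auto simp: big_cell_def coord_flag_point flag_minor_eq_0)

lemma regular_on_big_cell_coord:
  assumes "r < m" "c < m"
  shows "regular_on_flags m (big_cell m) (coord m r c)"
proof (rule regular_on_flagsI)
  fix g assume "g \<in> GL m" "flag_point m g \<in> big_cell m"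
  thus "\<exists>a\<in>poly_funs m. \<exists>b\<in>poly_funs m. \<exists>W. openin (GL_top m) W \<and> g \<in> W \<and>
     (\<forall>x\<in>W. x \<in> GL m \<and> flag_point m x \<in> big_cell m \<and> b x \<noteq> 0 \<and> coord m r c (flag_point m x) = a x / b x)"
    using assms openin_GL_big_cell[of m]
    by (intro bexI[of _ "flag_minor r c"] bexI[of _ "flag_minor c c"]
        exI[of _ "{g \<in> GL m. flag_point m g \<in> big_cell m}"])
      (auto simp: coord_flag_point flag_minor_poly flag_point_in_big_cell_iff)
qed

text \<open>The \<open>LU\<close> decomposition: by \<open>flag_minor_expand\<close>, \<open>chart m F = g * b\<close> with \<open>b\<close> upper triangular.\<close>

lemma chart_big_cell:
  assumes "F \<in> big_cell m"
  shows "chart m F \<in> GL m" "flag_point m (chart m F) = F"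
proof -
  obtain g where g: "g \<in> GL m" "\<forall>c<m. flag_minor c c g \<noteq> 0" "F = flag_point m g"
    using assms by (auto simp: big_cell_def)
  define b where "b = mat m m (\<lambda>(j, c). if j \<le> c then cofactor (minor_mat c c g) c j / flag_minor c c g else 0)"
  have bc: "b \<in> carrier_mat m m" by (simp add: b_def)
  \<comment> \<open>By \<open>cofactor_minor_mat_last\<close> the diagonal entries of
    \<open>b\<close> are quotients of consecutive principal minors, with 1 as the numerator at
    \<open>c = 0\<close>.\<close>
  have "b \<in> Borel m"
    unfolding Borel_iff using g(2) by (auto simp: b_def upper_triangular_def cofactor_minor_mat_last)
  have "chart m F = g * b"
  proof (rule eq_matI)
    fix r c assume "r < dim_row (g * b)" "c < dim_col (g * b)"
    hence rc: "r < m" "c < m" using GL_carrier[OF g(1)] bc by auto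
    have "(g * b) $$ (r, c) = (\<Sum>h<m. g $$ (r, h) * b $$ (h, c))"
      by (rule mat_mult_entry[OF GL_carrier[OF g(1)] bc rc])
    also have "\<dots> = (\<Sum>h<Suc c. g $$ (r, h) * b $$ (h, c))"
      using rc by (intro sum.mono_neutral_right) (auto simp: b_def)
    also have "\<dots> = (\<Sum>h<Suc c. g $$ (r, h) * cofactor (minor_mat c c g) c h) / flag_minor c c g"
      unfolding sum_divide_distrib using rc by (intro sum.cong) (auto simp: b_def)
    also have "\<dots> = chart m F $$ (r, c)"
      unfolding flag_minor_expand[of r c g, symmetric] using rc g by (simp add: chart_def coord_flag_point)
    finally show "chart m F $$ (r, c) = (g * b) $$ (r, c)" by simp
  qed (use GL_carrier[OF g(1)] bc in \<open>auto simp: chart_def\<close>)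
  thus "chart m F \<in> GL m" "flag_point m (chart m F) = F"
    using g \<open>b \<in> Borel m\<close> GL_mult_closed flag_point_mult_Borel[OF GL_carrier[OF g(1)]]
    by (auto simp: Borel_def)
qed

lemma unitriangular_flag:
  assumes "L \<in> carrier_mat m m"
    "\<And>i j. i < j \<Longrightarrow> j < m \<Longrightarrow> L $$ (i, j) = 0" "\<And>i. i < m \<Longrightarrow> L $$ (i, i) = 1"
  shows "L \<in> GL m" "flag_point m L \<in> big_cell m" "chart m (flag_point m L) = L"
proof -
  have "det L = 1"
    using det_lower_triangular[OF assms(2) assms(1)] assms by (simp add: prod_list_diag_prod)
  thus L: "L \<in> GL m" using assms(1) by (simp add: GL_iff_det)
  have fm: "flag_minor r c L = L $$ (r, c)" if "r < m" "c < m" for r c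
  proof (cases "r < c")
    case True thus ?thesis using that assms by (simp add: flag_minor_eq_0)
  next
    case False thus ?thesis using that assms by (intro flag_minor_unitriangular[of m]) auto
  qed
  show "flag_point m L \<in> big_cell m" using L fm assms(3) by (simp add: flag_point_in_big_cell_iff)
  show "chart m (flag_point m L) = L"
    using assms(1,3) L fm by (intro eq_matI) (auto simp: chart_def coord_flag_point)
qed

lemma coord_eq_chart: "r < m \<Longrightarrow> c < m \<Longrightarrow> coord m r c F = chart m F $$ (r, c)"
  by (simp add: chart_def)

lemma standard_flag_in_big_cell: "standard_flag m \<in> big_cell m"
  and chart_standard_flag: "chart m (standard_flag m) = 1\<^sub>m m"
  unfolding standard_flag_def using unitriangular_flag[of "1\<^sub>m m" m] by auto

section \<open>Powers of the maximal ideal\<close>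

locale germs =
  fixes m :: nat and X :: "complex mat set set" and p :: "complex mat set"
  assumes point_mem: "p \<in> X" and variety_subset: "X \<subseteq> flags m"
begin

abbreviation A where "A \<equiv> regular_near_ring m X p"
abbreviation R where "R \<equiv> local_ring m X p"
abbreviation M where "M \<equiv> local_max_ideal m X p"
abbreviation gm where "gm \<equiv> germ m X p"
abbreviation reg where "reg \<equiv> regular_near m X p"

text \<open>Equality of germs for arbitrary functions, so that it can also transfer regularity from
  one to the other (\<open>reg_cong\<close>).\<close>

definition eq_near :: "(complex mat set \<Rightarrow> complex) \<Rightarrow> (complex mat set \<Rightarrow> complex) \<Rightarrow> bool" where
  "eq_near f g \<longleftrightarrow> (\<exists>U. openin (flag_top m) U \<and> p \<in> U \<and> (\<forall>x\<in>X \<inter> U. f x = g x))"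

lemma point_flag: "p \<in> flags m"
  using point_mem variety_subset by blast

sublocale A: cring A by (rule cring_regular_near_ring[OF point_flag])

sublocale V: ideal "vanishing_near m X p" A by (rule ideal_vanishing_near[OF point_flag])

sublocale R: cring R
  unfolding local_ring_def by (rule V.quotient_is_cring[OF A.is_cring])

sublocale germ: ring_hom_ring A R gm
  using V.rcos_ring_hom_ring unfolding local_ring_def germ_def[abs_def] .

lemma A_simps: "carrier A = reg" "f \<oplus>\<^bsub>A\<^esub> g = (\<lambda>x. f x + g x)" "f \<otimes>\<^bsub>A\<^esub> g = (\<lambda>x. f x * g x)"
    "\<one>\<^bsub>A\<^esub> = (\<lambda>_. 1)" "\<zero>\<^bsub>A\<^esub> = (\<lambda>_. 0)"
  by (simp_all add: regular_near_ring_def)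

lemma reg_const: "(\<lambda>_. c) \<in> reg"
  by (rule regular_near_const[OF point_flag])

lemma reg_add: "f \<in> reg \<Longrightarrow> g \<in> reg \<Longrightarrow> (\<lambda>x. f x + g x) \<in> reg"
  and reg_mult: "f \<in> reg \<Longrightarrow> g \<in> reg \<Longrightarrow> (\<lambda>x. f x * g x) \<in> reg"
  by (rule regular_near_combine; assumption)+

lemma reg_minus: "f \<in> reg \<Longrightarrow> (\<lambda>x. - f x) \<in> reg"
  using reg_mult[OF reg_const[of "- 1"]] by simp

lemma reg_diff: "f \<in> reg \<Longrightarrow> g \<in> reg \<Longrightarrow> (\<lambda>x. f x - g x) \<in> reg"
  using reg_add[OF _ reg_minus] by simp

lemma A_minus: "f \<in> reg \<Longrightarrow> \<ominus>\<^bsub>A\<^esub> f = (\<lambda>x. - f x)"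
  by (rule A.minus_equality) (simp_all add: A_simps reg_minus)

lemma germ_add: "f \<in> reg \<Longrightarrow> g \<in> reg \<Longrightarrow> gm (\<lambda>x. f x + g x) = gm f \<oplus>\<^bsub>R\<^esub> gm g"
  and germ_mult: "f \<in> reg \<Longrightarrow> g \<in> reg \<Longrightarrow> gm (\<lambda>x. f x * g x) = gm f \<otimes>\<^bsub>R\<^esub> gm g"
  and germ_one: "gm (\<lambda>_. 1) = \<one>\<^bsub>R\<^esub>" and germ_zero: "gm (\<lambda>_. 0) = \<zero>\<^bsub>R\<^esub>"
  and germ_closed: "f \<in> reg \<Longrightarrow> gm f \<in> carrier R"
  using germ.hom_add[of f g] germ.hom_mult[of f g] germ.hom_one germ.hom_zero germ.hom_closed[of f]
  by (simp_all add: A_simps)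

lemma germ_minus: "f \<in> reg \<Longrightarrow> gm (\<lambda>x. - f x) = \<ominus>\<^bsub>R\<^esub> gm f"
  using germ.hom_a_inv[of f] by (simp add: A_simps A_minus)

lemma carrier_local_ring: "carrier R = gm ` reg"
  by (auto simp: local_ring_def FactRing_def A_RCOSETS_def' germ_def A_simps)

lemma germ_eq_iff: "f \<in> reg \<Longrightarrow> g \<in> reg \<Longrightarrow> gm f = gm g \<longleftrightarrow> eq_near f g"
  using A.quotient_eq_iff_same_a_r_cos[OF V.is_ideal, of f g]
  by (simp add: A_simps germ_def A.minus_eq A_minus vanishing_near_def eq_near_def)

lemma reg_cong: "f \<in> reg \<Longrightarrow> eq_near f g \<Longrightarrow> g \<in> reg"
proof -
  assume "f \<in> reg" "eq_near f g"
  then obtain U V h where U: "openin (flag_top m) U" "p \<in> U" "\<forall>x\<in>X \<inter> U. f x = g x"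
    and V: "openin (flag_top m) V" "p \<in> V" "regular_on_flags m V h" "\<forall>x\<in>X \<inter> V. f x = h x"
    unfolding eq_near_def regular_near_def by blast
  have "\<forall>x\<in>X \<inter> (U \<inter> V). g x = h x" using U(3) V(4) by (metis Int_iff)
  moreover have "regular_on_flags m (U \<inter> V) h"
    using regular_on_flags_combine(1)[OF regular_on_flags_const[OF U(1), of 0] V(3)] by simp
  moreover have "openin (flag_top m) (U \<inter> V)" "p \<in> U \<inter> V" using U V by auto
  ultimately show "g \<in> reg" unfolding regular_near_def by blast
qed

lemma eq_near_point: "eq_near f g \<Longrightarrow> f p = g p"
  using point_mem by (auto simp: eq_near_def)

lemma max_idealE:
  assumes "F \<in> M" obtains f where "f \<in> reg" "f p = 0" "F = gm f"
  using assms by (auto simp: local_max_ideal_def)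

lemma germ_in_max_ideal_iff:
  assumes f: "f \<in> reg"
  shows "gm f \<in> M \<longleftrightarrow> f p = 0"
proof
  assume "gm f \<in> M"
  then obtain g where g: "g \<in> reg" "g p = 0" "gm f = gm g" by (elim max_idealE)
  show "f p = 0" using eq_near_point[of f g] germ_eq_iff[OF f g(1)] g(2,3) by simp
next
  assume "f p = 0"
  thus "gm f \<in> M" unfolding local_max_ideal_def using f by blast
qed

lemma ideal_local_max_ideal: "ideal M R"
proof (rule idealI)
  show "ring R" by (rule R.ring_axioms)
  show "subgroup M (add_monoid R)"
  proof (rule subgroup.intro)
    show "M \<subseteq> carrier (add_monoid R)" using germ_closed by (auto simp: local_max_ideal_def)
    show "\<one>\<^bsub>add_monoid R\<^esub> \<in> M"
      using germ_in_max_ideal_iff[OF reg_const, of 0] by (simp add: germ_zero)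
    fix F G assume "F \<in> M" "G \<in> M"
    then obtain f g where f: "f \<in> reg" "f p = 0" "F = gm f" and g: "g \<in> reg" "g p = 0" "G = gm g"
      by (elim max_idealE) blast
    show "F \<otimes>\<^bsub>add_monoid R\<^esub> G \<in> M"
      using f g germ_in_max_ideal_iff[OF reg_add[OF f(1) g(1)]] by (simp add: germ_add)
    have "inv\<^bsub>add_monoid R\<^esub> F = gm (\<lambda>x. - f x)"
      using f by (simp add: germ_minus a_inv_def)
    thus "inv\<^bsub>add_monoid R\<^esub> F \<in> M"
      using f germ_in_max_ideal_iff[OF reg_minus[OF f(1)]] by simp
  qed
  fix F G assume "F \<in> M" "G \<in> carrier R"
  then obtain f g where f: "f \<in> reg" "f p = 0" "F = gm f" and g: "g \<in> reg" "G = gm g"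
    by (elim max_idealE) (auto simp: carrier_local_ring)
  show "G \<otimes>\<^bsub>R\<^esub> F \<in> M" "F \<otimes>\<^bsub>R\<^esub> G \<in> M"
    using f g germ_in_max_ideal_iff[OF reg_mult[OF f(1) g(1)]] germ_in_max_ideal_iff[OF reg_mult[OF g(1) f(1)]]
    by (simp_all add: germ_mult)
qed

text \<open>The preimage of \<open>M\<^sup>k\<close> among functions. It allows the filtration to be
  handled with functions in place of cosets.\<close>

definition order_ge :: "nat \<Rightarrow> (complex mat set \<Rightarrow> complex) set" where
  "order_ge k = {f \<in> reg. gm f \<in> ideal_power R M k}"

lemma ideal_max_ideal_power: "ideal (ideal_power R M k) R"
  by (rule ideal_ideal_power[OF R.is_cring ideal_local_max_ideal])

lemma order_ge_0: "order_ge 0 = reg"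
  using germ_closed by (auto simp: order_ge_def)

lemma order_ge_reg: "f \<in> order_ge k \<Longrightarrow> f \<in> reg"
  by (simp add: order_ge_def)

lemma order_ge_cong: "f \<in> order_ge k \<Longrightarrow> eq_near f g \<Longrightarrow> g \<in> order_ge k"
  using reg_cong[of f g] germ_eq_iff[of f g] by (auto simp: order_ge_def)

lemma order_ge_zero: "(\<lambda>_. 0) \<in> order_ge k"
proof -
  interpret I: ideal "ideal_power R M k" R by (rule ideal_max_ideal_power)
  show ?thesis using reg_const I.zero_closed by (simp add: order_ge_def germ_zero)
qed

lemma order_ge_add: "f \<in> order_ge k \<Longrightarrow> g \<in> order_ge k \<Longrightarrow> (\<lambda>x. f x + g x) \<in> order_ge k"
proof -
  interpret I: ideal "ideal_power R M k" R by (rule ideal_max_ideal_power)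
  assume "f \<in> order_ge k" "g \<in> order_ge k"
  thus ?thesis using reg_add I.a_closed by (simp add: order_ge_def germ_add)
qed

lemma max_ideal_power_mult:
  assumes "F \<in> ideal_power R M a" "G \<in> ideal_power R M b"
  shows "F \<otimes>\<^bsub>R\<^esub> G \<in> ideal_power R M (a + b)"
  using assms(1)
proof (induction a arbitrary: F)
  case 0
  thus ?case using ideal.I_l_closed[OF ideal_max_ideal_power assms(2)] by simp
next
  case (Suc a)
  have G: "G \<in> carrier R" using ideal.Icarr[OF ideal_max_ideal_power assms(2)] .
  have "F \<in> ideal_prod R M (ideal_power R M a)" using Suc.prems by simp
  thus ?case
  proof (induction rule: ideal_prod.induct)
    case (prod i j)
    have "i \<in> carrier R" "j \<in> carrier R"
      using prod ideal.Icarr[OF ideal_local_max_ideal] ideal.Icarr[OF ideal_max_ideal_power] by blast+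
    hence "i \<otimes>\<^bsub>R\<^esub> j \<otimes>\<^bsub>R\<^esub> G = i \<otimes>\<^bsub>R\<^esub> (j \<otimes>\<^bsub>R\<^esub> G)" using G by (simp add: R.m_assoc)
    thus ?case using ideal_prod.prod[OF prod(1) Suc.IH[OF prod(2)], of R] by simp
  next
    case (sum s t)
    have "s \<in> carrier R" "t \<in> carrier R"
      using sum(1,2) ideal.Icarr[OF ideal_max_ideal_power[of "Suc a"]] by auto
    thus ?case using ideal_prod.sum[of _ R M "ideal_power R M (a + b)"] sum G by (simp add: R.l_distr)
  qed
qed

lemma order_ge_mult: "f \<in> order_ge a \<Longrightarrow> g \<in> order_ge b \<Longrightarrow> (\<lambda>x. f x * g x) \<in> order_ge (a + b)"
  using max_ideal_power_mult by (simp add: order_ge_def germ_mult reg_mult)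

lemma order_ge_mult_reg: "f \<in> reg \<Longrightarrow> g \<in> order_ge b \<Longrightarrow> (\<lambda>x. f x * g x) \<in> order_ge b"
  using order_ge_mult[of f 0 g b] by (simp add: order_ge_0)

lemma order_ge_sum: "(\<And>i. i \<in> I \<Longrightarrow> f i \<in> order_ge k) \<Longrightarrow> (\<lambda>x. \<Sum>i\<in>I. f i x) \<in> order_ge k"
  by (induction I rule: infinite_finite_induct) (auto intro: order_ge_add order_ge_zero)

lemma order_ge_1I: "f \<in> reg \<Longrightarrow> f p = 0 \<Longrightarrow> f \<in> order_ge (Suc 0)"
  using ideal_prod.prod[of "gm f" M "\<one>\<^bsub>R\<^esub>" "carrier R" R] germ_closed[of f]
  by (simp add: order_ge_def germ_in_max_ideal_iff)

lemma order_ge_Suc_point: "f \<in> order_ge (Suc k) \<Longrightarrow> f p = 0"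
  using R.ideal_prod_inter[OF ideal_local_max_ideal ideal_max_ideal_power[of k]] germ_in_max_ideal_iff[of f]
  by (auto simp: order_ge_def)

text \<open>Induction over the products and sums that make up \<open>M * M\<^sup>k\<close>. The case
  \<open>cong\<close> is there because a germ determines its representative only near
  \<open>p\<close> and on \<open>X\<close>.\<close>

lemma order_ge_Suc_induct [consumes 1, case_names mult add cong]:
  assumes "f \<in> order_ge (Suc k)"
    and mult: "\<And>f g. f \<in> reg \<Longrightarrow> f p = 0 \<Longrightarrow> g \<in> order_ge k \<Longrightarrow> P (\<lambda>x. f x * g x)"
    and add: "\<And>f g. f \<in> reg \<Longrightarrow> g \<in> reg \<Longrightarrow> P f \<Longrightarrow> P g \<Longrightarrow> P (\<lambda>x. f x + g x)"
    and cong: "\<And>f g. f \<in> reg \<Longrightarrow> g \<in> reg \<Longrightarrow> P f \<Longrightarrow> eq_near f g \<Longrightarrow> P g"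
  shows "P f"
proof -
  have "\<exists>f. f \<in> reg \<and> F = gm f \<and> P f" if "F \<in> ideal_prod R M (ideal_power R M k)" for F
    using that
  proof (induction rule: ideal_prod.induct)
    case (prod i j)
    obtain f where f: "f \<in> reg" "f p = 0" "i = gm f" using prod(1) by (rule max_idealE)
    have "j \<in> carrier R" using ideal.Icarr[OF ideal_max_ideal_power prod(2)] .
    then obtain g where g: "g \<in> reg" "j = gm g" by (auto simp: carrier_local_ring)
    hence "g \<in> order_ge k" using prod(2) by (simp add: order_ge_def)
    hence "P (\<lambda>x. f x * g x)" by (rule mult[OF f(1,2)])
    thus ?case using f g by (intro exI[of _ "\<lambda>x. f x * g x"]) (simp add: germ_mult reg_mult)
  next
    case (sum s t)
    then obtain f g where "f \<in> reg" "s = gm f" "P f" "g \<in> reg" "t = gm g" "P g" by blast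
    thus ?case using add by (intro exI[of _ "\<lambda>x. f x + g x"]) (simp add: germ_add reg_add)
  qed
  moreover have "gm f \<in> ideal_prod R M (ideal_power R M k)" using assms(1) by (simp add: order_ge_def)
  ultimately obtain g where "g \<in> reg" "gm f = gm g" "P g" by blast
  thus ?thesis using cong[of g f] assms(1) order_ge_reg germ_eq_iff by metis
qed

lemma gr_Hilbert_function_local_ring:
  fixes e :: "'i \<Rightarrow> complex mat set \<Rightarrow> complex"
  assumes fin: "finite B" and e: "\<And>i. i \<in> B \<Longrightarrow> e i \<in> order_ge k"
    and ind: "\<And>c i. (\<lambda>x. \<Sum>i\<in>B. c i * e i x) \<in> order_ge (Suc k) \<Longrightarrow> i \<in> B \<Longrightarrow> c i = 0"
    and span: "\<And>f. f \<in> order_ge k \<Longrightarrow> \<exists>c. (\<lambda>x. f x - (\<Sum>i\<in>B. c i * e i x)) \<in> order_ge (Suc k)"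
  shows "gr_Hilbert_function R (local_constants m X p) M k = card B"
proof -
  obtain ks where ks: "set ks = B" "distinct ks" using finite_distinct_list[OF fin] by blast
  define us where "us = map (\<lambda>i. gm (e i)) ks"
  define \<kappa> where "\<kappa> = (\<lambda>c. gm (\<lambda>_. c))"
  have comb: "R.combine (map \<kappa> (map c js)) (map (\<lambda>i. gm (e i)) js) = gm (\<lambda>x. \<Sum>i\<leftarrow>js. c i * e i x)"
    and comb_reg: "(\<lambda>x. \<Sum>i\<leftarrow>js. c i * e i x) \<in> reg"
    if "set js \<subseteq> B" for c js
  proof -
    have "R.combine (map \<kappa> (map c js)) (map (\<lambda>i. gm (e i)) js) = gm (\<lambda>x. \<Sum>i\<leftarrow>js. c i * e i x) \<and>
      (\<lambda>x. \<Sum>i\<leftarrow>js. c i * e i x) \<in> reg"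
      using that
    proof (induction js)
      case (Cons j js)
      have "e j \<in> reg" using e order_ge_reg Cons.prems by auto
      hence "(\<lambda>x. c j * e j x) \<in> reg" using reg_mult[OF reg_const] by blast
      thus ?case using Cons \<open>e j \<in> reg\<close>
        by (simp add: germ_add reg_add germ_mult[OF reg_const] \<kappa>_def)
    qed (simp add: germ_zero reg_const)
    thus "R.combine (map \<kappa> (map c js)) (map (\<lambda>i. gm (e i)) js) = gm (\<lambda>x. \<Sum>i\<leftarrow>js. c i * e i x)"
      "(\<lambda>x. \<Sum>i\<leftarrow>js. c i * e i x) \<in> reg" by blast+
  qed
  have sum_list_eq: "(\<lambda>x. \<Sum>i\<leftarrow>ks. c i * e i x) = (\<lambda>x. \<Sum>i\<in>B. c i * e i x)" for c
    using ks by (simp add: sum_list_distinct_conv_sum_set)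
  have combB: "R.combine (map \<kappa> (map c ks)) us = gm (\<lambda>x. \<Sum>i\<in>B. c i * e i x)"
    and combB_reg: "(\<lambda>x. \<Sum>i\<in>B. c i * e i x) \<in> reg" for c
    using comb[of ks c] comb_reg[of ks c] ks by (simp_all add: us_def sum_list_eq)
  have "gr_Hilbert_function R (range \<kappa>) M k = length us"
  proof (rule gr_Hilbert_function_eqI[OF R.is_cring ideal_local_max_ideal])
    show "\<kappa> c \<in> carrier R" for c unfolding \<kappa>_def by (rule germ_closed[OF reg_const])
    show "\<kappa> 1 = \<one>\<^bsub>R\<^esub>" unfolding \<kappa>_def by (rule germ_one)
    show "\<kappa> (c + d) = \<kappa> c \<oplus>\<^bsub>R\<^esub> \<kappa> d" for c d unfolding \<kappa>_def using germ_add[OF reg_const reg_const] .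
    show "\<kappa> (c * d) = \<kappa> c \<otimes>\<^bsub>R\<^esub> \<kappa> d" for c d unfolding \<kappa>_def using germ_mult[OF reg_const reg_const] .
    show "set us \<subseteq> ideal_power R M k" using e ks by (auto simp: us_def order_ge_def)
    show "\<one>\<^bsub>R\<^esub> \<notin> ideal_power R M (Suc k)"
    proof
      assume "\<one>\<^bsub>R\<^esub> \<in> ideal_power R M (Suc k)"
      hence "(\<lambda>_. 1) \<in> order_ge (Suc k)" using reg_const germ_one by (simp add: order_ge_def)
      thus False using order_ge_Suc_point by fastforce
    qed
    fix cs assume cs: "length cs = length us" "R.combine (map \<kappa> cs) us \<in> ideal_power R M (Suc k)"
    have "length cs = length ks" using cs(1) by (simp add: us_def)
    \<comment> \<open>Since the indices in \<open>ks\<close> are distinct, every list of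
      coefficients comes from a function on \<open>B\<close>.\<close>
    hence "\<exists>c. cs = map c ks" using ks(2)
    proof (induction cs ks rule: list_induct2)
      case (Cons a cs i js)
      then obtain c where "cs = map c js" by auto
      thus ?case using Cons.prems by (intro exI[of _ "c(i := a)"]) auto
    qed simp
    then obtain c where c: "cs = map c ks" ..
    have "(\<lambda>x. \<Sum>i\<in>B. c i * e i x) \<in> order_ge (Suc k)"
      using cs(2) combB_reg unfolding c combB by (simp add: order_ge_def)
    thus "set cs \<subseteq> {0}" using ind[of c] ks unfolding c by auto
  next
    fix F assume F: "F \<in> ideal_power R M k"
    hence "F \<in> carrier R" using ideal.Icarr[OF ideal_max_ideal_power] by blast
    then obtain f where f: "f \<in> reg" "F = gm f" by (auto simp: carrier_local_ring)
    hence "f \<in> order_ge k" using F by (simp add: order_ge_def)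
    then obtain c where c: "(\<lambda>x. f x - (\<Sum>i\<in>B. c i * e i x)) \<in> order_ge (Suc k)" using span by blast
    have "F = gm (\<lambda>x. (\<Sum>i\<in>B. c i * e i x) + (f x - (\<Sum>i\<in>B. c i * e i x)))" using f by simp
    also have "\<dots> = gm (\<lambda>x. \<Sum>i\<in>B. c i * e i x) \<oplus>\<^bsub>R\<^esub> gm (\<lambda>x. f x - (\<Sum>i\<in>B. c i * e i x))"
      by (rule germ_add[OF combB_reg order_ge_reg[OF c]])
    also have "gm (\<lambda>x. \<Sum>i\<in>B. c i * e i x) = R.combine (map \<kappa> (map c ks)) us" by (rule combB[symmetric])
    finally show "\<exists>cs. \<exists>y\<in>ideal_power R M (Suc k). length cs = length us \<and> F = R.combine (map \<kappa> cs) us \<oplus>\<^bsub>R\<^esub> y"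
      using c by (intro exI[of _ "map c ks"] bexI[of _ "gm (\<lambda>x. f x - (\<Sum>i\<in>B. c i * e i x))"])
        (simp_all add: us_def order_ge_def)
  qed
  moreover have "range \<kappa> = local_constants m X p" by (simp add: local_constants_def \<kappa>_def)
  moreover have "length us = card B" using ks by (simp add: us_def distinct_card[symmetric])
  ultimately show ?thesis by simp
qed

end

section \<open>The Schubert cell\<close>

abbreviation schubert_cell :: "nat \<Rightarrow> (nat \<Rightarrow> nat) \<Rightarrow> complex mat set set" where
  "schubert_cell m w \<equiv> {flag_point m (b * perm_matrix m w) |b. b \<in> Borel m}"

lemma perm_matrix_carrier [simp]: "perm_matrix m w \<in> carrier_mat m m"
  by (simp add: perm_matrix_def)

lemma mult_perm_matrix_w':
  assumes "M \<in> carrier_mat (n + 2) (n + 2)" "i < n + 2" "j < n + 2"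
  shows "(M * perm_matrix (n + 2) (w' n)) $$ (i, j) =
    M $$ (i, if j = 0 then n + 1 else if j = n + 1 then 0 else j)" (is "_ = M $$ (i, ?s)")
proof -
  have "w' n (Suc j) = Suc ?s" using assms(3) by (auto simp: w'_def)
  have "(M * perm_matrix (n + 2) (w' n)) $$ (i, j) = (\<Sum>h<n + 2. M $$ (i, h) * perm_matrix (n + 2) (w' n) $$ (h, j))"
    by (rule mat_mult_entry[OF assms(1) perm_matrix_carrier assms(2,3)])
  also have "\<dots> = (\<Sum>h<n + 2. if h = ?s then M $$ (i, ?s) else 0)"
    using assms(3) \<open>w' n (Suc j) = Suc ?s\<close> by (intro sum.cong) (auto simp: perm_matrix_def)
  also have "\<dots> = M $$ (i, ?s)"
    using assms(3) by (subst sum.delta) auto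
  finally show ?thesis .
qed

lemma perm_matrix_w'_GL: "perm_matrix (n + 2) (w' n) \<in> GL (n + 2)"
proof -
  have "perm_matrix (n + 2) (w' n) * perm_matrix (n + 2) (w' n) = 1\<^sub>m (n + 2)"
  proof (rule eq_matI)
    fix i j assume "i < dim_row (1\<^sub>m (n + 2))" "j < dim_col (1\<^sub>m (n + 2))"
    hence ij: "i < n + 2" "j < n + 2" by auto
    show "(perm_matrix (n + 2) (w' n) * perm_matrix (n + 2) (w' n)) $$ (i, j) = 1\<^sub>m (n + 2) $$ (i, j)"
      unfolding mult_perm_matrix_w'[OF perm_matrix_carrier ij]
      using ij by (auto simp: perm_matrix_def w'_def)
  qed (simp_all add: perm_matrix_def)
  thus ?thesis using GL_I[OF perm_matrix_carrier perm_matrix_carrier] by blast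
qed

lemma schubert_cell_subset: "schubert_cell (n + 2) (w' n) \<subseteq> flags (n + 2)"
  using GL_mult_closed[OF _ perm_matrix_w'_GL] by (auto simp: flags_def Borel_def)

text \<open>In a row \<open>r > c\<close> the columns \<open>1..c\<close> of \<open>g\<close> are
  columns of the upper triangular \<open>b\<close> and vanish, so the expansion of the minor along
  row \<open>r\<close> keeps only its first term. The entry is \<open>u r\<close>, and the cofactor
  over the principal minor, which does not involve \<open>r\<close>, is \<open>v c\<close>. The
  identity also holds off the big cell, where a vanishing principal minor makes both sides
  0.\<close>

lemma schubert_cell_coord:
  assumes "F \<in> schubert_cell (n + 2) (w' n)"
  obtains u v where "\<And>r c. c < r \<Longrightarrow> r < n + 2 \<Longrightarrow> coord (n + 2) r c F = u r * v c"
proof -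
  obtain b where b: "b \<in> Borel (n + 2)" "F = flag_point (n + 2) (b * perm_matrix (n + 2) (w' n))"
    using assms by blast
  define g where "g = b * perm_matrix (n + 2) (w' n)"
  have g: "g \<in> GL (n + 2)" unfolding g_def using b GL_mult_closed perm_matrix_w'_GL by (auto simp: Borel_def)
  have bc: "b \<in> carrier_mat (n + 2) (n + 2)" using b(1) by (rule Borel_carrier)
  have "coord (n + 2) r c F = g $$ (r, 0) * (cofactor (minor_mat c c g) c 0 / flag_minor c c g)"
    if "c < r" "r < n + 2" for r c
  proof -
    have "g $$ (r, j) = 0" if "j \<in> {..<Suc c} - {0}" for j
      unfolding g_def using that \<open>c < r\<close> \<open>r < n + 2\<close> Borel_zero[OF b(1), of r j]
      by (subst mult_perm_matrix_w'[OF bc]) auto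
    hence "flag_minor r c g = (\<Sum>j\<in>{0}. g $$ (r, j) * cofactor (minor_mat c c g) c j)"
      unfolding flag_minor_expand[of r c g] by (intro sum.mono_neutral_right) auto
    moreover have "coord (n + 2) r c F = flag_minor r c g / flag_minor c c g"
      unfolding b(2) g_def[symmetric] using that by (intro coord_flag_point g) auto
    ultimately show ?thesis by simp
  qed
  thus ?thesis by (rule that)
qed

section \<open>Monomials in the coordinates, on the orbit and on its closure\<close>

definition coord_monomial :: "nat \<Rightarrow> nat list \<times> nat list \<Rightarrow> complex mat set \<Rightarrow> complex" where
  "coord_monomial m p F = (\<Prod>(c, r)\<leftarrow>zip (fst p) (snd p). coord m r c F)"

lemma coord_monomial_Nil [simp]: "coord_monomial m ([], rs) = (\<lambda>_. 1)"
  and coord_monomial_Cons [simp]: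
    "coord_monomial m (c # cs, r # rs) = (\<lambda>F. coord m r c F * coord_monomial m (cs, rs) F)"
  by (auto simp: coord_monomial_def)

lemma coord_monomial_split:
  assumes "list_all2 (<) cs rs" "set rs \<subseteq> {..<m}"
    and "\<And>r c. c < r \<Longrightarrow> r < m \<Longrightarrow> coord m r c F = u r * v c"
  shows "coord_monomial m (cs, rs) F = prod_mset (image_mset v (mset cs)) * prod_mset (image_mset u (mset rs))"
  using assms(1,2) by (induction cs rs rule: list_all2_induct) (auto simp: assms(3) mult_ac)

lemma regular_on_big_cell_monomial:
  assumes "list_all2 (<) cs rs" "set rs \<subseteq> {..<m}"
  shows "regular_on_flags m (big_cell m) (coord_monomial m (cs, rs))"
  using assms
proof (induction cs rs rule: list_all2_induct)
  case Nil
  show ?case using regular_on_flags_const[OF openin_big_cell, of m 1] by simp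
next
  case (Cons c cs r rs)
  have "regular_on_flags m (big_cell m) (coord m r c)"
    using Cons.hyps Cons.prems by (intro regular_on_big_cell_coord) auto
  from regular_on_flags_combine(2)[OF this, of "big_cell m"] Cons show ?case by simp
qed

text \<open>The set where \<open>f - g\<close> does not vanish is open and misses the orbit, hence
  misses its closure.\<close>

lemma regular_on_big_cell_eq_on_Schubert_variety:
  assumes "regular_on_flags m (big_cell m) f" "regular_on_flags m (big_cell m) g"
    and "\<And>F. F \<in> schubert_cell m w \<Longrightarrow> f F = g F"
    and "F \<in> Schubert_variety m w" "F \<in> big_cell m"
  shows "f F = g F"
proof (rule ccontr)
  assume "f F \<noteq> g F"
  have "regular_on_flags m (big_cell m) (\<lambda>x. (- 1) * g x)"
    using regular_on_flags_combine(2)[OF regular_on_flags_const[OF openin_big_cell, of m "- 1"] assms(2)] by simp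
  hence "regular_on_flags m (big_cell m) (\<lambda>x. f x + (- 1) * g x)"
    using regular_on_flags_combine(1)[OF assms(1)] by fastforce
  hence "openin (flag_top m) {x \<in> big_cell m. f x + (- 1) * g x \<noteq> 0}"
    using openin_flag_nonvanishing big_cell_subset by blast
  moreover have "{x \<in> big_cell m. f x + (- 1) * g x \<noteq> 0} \<inter> schubert_cell m w = {}"
    using assms(3) by auto
  ultimately have "{x \<in> big_cell m. f x + (- 1) * g x \<noteq> 0} \<inter> Schubert_variety m w = {}"
    unfolding Schubert_variety_def using openin_Int_closure_of_eq_empty by blast
  moreover have "F \<in> {x \<in> big_cell m. f x + (- 1) * g x \<noteq> 0} \<inter> Schubert_variety m w"
    using assms(4,5) \<open>f F \<noteq> g F\<close> by auto
  ultimately show False by blast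
qed

lemma coord_monomial_eq_on_Schubert_variety:
  assumes "list_all2 (<) cs rs" "list_all2 (<) cs' rs'" "mset cs = mset cs'" "mset rs = mset rs'"
    and "set rs \<subseteq> {..<n + 2}"
    and "F \<in> Schubert_variety (n + 2) (w' n)" "F \<in> big_cell (n + 2)"
  shows "coord_monomial (n + 2) (cs, rs) F = coord_monomial (n + 2) (cs', rs') F"
proof (rule regular_on_big_cell_eq_on_Schubert_variety[OF _ _ _ assms(6,7)])
  have s: "set rs' \<subseteq> {..<n + 2}" using assms(4,5) by (metis mset_eq_setD)
  show "regular_on_flags (n + 2) (big_cell (n + 2)) (coord_monomial (n + 2) (cs, rs))"
    "regular_on_flags (n + 2) (big_cell (n + 2)) (coord_monomial (n + 2) (cs', rs'))"
    using regular_on_big_cell_monomial assms s by blast+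
  fix F assume "F \<in> schubert_cell (n + 2) (w' n)"
  then obtain u v where "\<And>r c. c < r \<Longrightarrow> r < n + 2 \<Longrightarrow> coord (n + 2) r c F = u r * v c"
    by (rule schubert_cell_coord) blast
  thus "coord_monomial (n + 2) (cs, rs) F = coord_monomial (n + 2) (cs', rs') F"
    using coord_monomial_split[OF assms(1,5)] coord_monomial_split[OF assms(2) s] assms(3,4) by metis
qed

section \<open>Curves through the standard flag\<close>

definition curve_mat :: "nat \<Rightarrow> (nat \<Rightarrow> complex) \<Rightarrow> (nat \<Rightarrow> complex) \<Rightarrow> complex \<Rightarrow> complex mat" where
  "curve_mat m u v t = mat m m (\<lambda>(i, j). if i = j then 1 else if j < i then t * u i * v j else 0)"

abbreviation curve :: "nat \<Rightarrow> (nat \<Rightarrow> complex) \<Rightarrow> (nat \<Rightarrow> complex) \<Rightarrow> complex \<Rightarrow> complex mat set" where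
  "curve m u v t \<equiv> flag_point m (curve_mat m u v t)"

lemma curve_mat_carrier [simp]: "curve_mat m u v t \<in> carrier_mat m m"
  by (simp add: curve_mat_def)

lemma curve_mat_0: "curve_mat m u v 0 = 1\<^sub>m m"
  by (rule eq_matI) (auto simp: curve_mat_def)

lemma curve_mat_GL: "curve_mat m u v t \<in> GL m"
  and chart_curve: "chart m (curve m u v t) = curve_mat m u v t"
  using unitriangular_flag[of "curve_mat m u v t" m] by (auto simp: curve_mat_def)

lemma poly_funs_curve:
  assumes "a \<in> poly_funs m"
  obtains q where "\<And>t. a (curve_mat m u v t) = poly q t"
proof -
  have "\<exists>q. \<forall>t. a (curve_mat m u v t) = poly q t"
    using assms
  proof (induction rule: poly_funs.induct)
    case (const c)
    show ?case by (rule exI[of _ "[:c:]"]) simp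
  next
    case (entry i j)
    thus ?case
      by (intro exI[of _ "if i = j then 1 else if j < i then [:0, u i * v j:] else 0"])
        (auto simp: curve_mat_def)
  next
    case (add a b)
    then obtain p q where "\<forall>t. a (curve_mat m u v t) = poly p t" "\<forall>t. b (curve_mat m u v t) = poly q t" by blast
    thus ?case by (intro exI[of _ "p + q"]) simp
  next
    case (mult a b)
    then obtain p q where "\<forall>t. a (curve_mat m u v t) = poly p t" "\<forall>t. b (curve_mat m u v t) = poly q t" by blast
    thus ?case by (intro exI[of _ "p * q"]) simp
  qed
  thus ?thesis using that by blast
qed

lemma eventually_poly_nonzero:
  assumes "poly q (0 :: complex) \<noteq> 0"
  shows "\<forall>\<^sub>F t in at 0. poly q t \<noteq> 0"
  using isContD[OF poly_isCont] assms by (rule tendsto_imp_eventually_ne)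

lemma eventually_curve_in_GL_open:
  assumes "openin (GL_top m) W" "1\<^sub>m m \<in> W"
  shows "\<forall>\<^sub>F t in at 0. curve_mat m u v t \<in> W"
proof -
  obtain a where a: "a \<in> poly_funs m" "a (1\<^sub>m m) \<noteq> 0" "{x \<in> GL m. a x \<noteq> 0} \<subseteq> W"
    using openin_GL_topE[OF assms] .
  obtain q where q: "\<And>t. a (curve_mat m u v t) = poly q t" using poly_funs_curve[OF a(1)] by blast
  have "poly q 0 \<noteq> 0" using a(2) q[of 0] by (simp add: curve_mat_0)
  from eventually_poly_nonzero[OF this] show ?thesis
    by eventually_elim (use a(3) q curve_mat_GL in auto)
qed

lemma eventually_curve_in_open:
  assumes "openin (flag_top m) U" "standard_flag m \<in> U"
  shows "\<forall>\<^sub>F t in at 0. curve m u v t \<in> U"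
proof -
  have "openin (GL_top m) {g \<in> GL m. flag_point m g \<in> U}" using assms(1) by (simp add: openin_flag_top)
  moreover have "1\<^sub>m m \<in> {g \<in> GL m. flag_point m g \<in> U}"
    using assms(2) one_in_Borel by (auto simp: standard_flag_def Borel_def)
  ultimately have "\<forall>\<^sub>F t in at 0. curve_mat m u v t \<in> {g \<in> GL m. flag_point m g \<in> U}"
    by (rule eventually_curve_in_GL_open)
  thus ?thesis by eventually_elim simp
qed

text \<open>
  The columns of the upper triangular matrix \<open>b\<close> below, with the first and the last one swapped,
  are combinations \<open>L * a\<close> of the columns of \<open>L = curve_mat (n + 2) u v t\<close>.
\<close>

lemma curve_in_schubert_cell:
  assumes t: "t \<noteq> 0" and u: "u (n + 1) \<noteq> 0" and v: "v 0 \<noteq> 0"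
    and ne: "\<And>j. j < n + 2 \<Longrightarrow> 1 - t * u j * v j \<noteq> 0"
  shows "curve (n + 2) u v t \<in> schubert_cell (n + 2) (w' n)"
proof -
  define m where "m = n + 2"
  define L where "L = curve_mat m u v t"
  \<comment> \<open>For \<open>1 \<le> j \<le> n\<close>, column \<open>j\<close> is that of
    \<open>L\<close> minus \<open>v j / v 0\<close> times its first column, which clears all entries
    below the diagonal because these have the form \<open>t * u i * v j\<close>. The last column is
    the first one of \<open>L\<close>, and the first is the first unit vector. The diagonal entries
    \<open>1\<close>, \<open>1 - t * u j * v j\<close> and \<open>t * u (n + 1) * v 0\<close>
    account for the assumptions.\<close>
  define b where "b = mat m m (\<lambda>(i, j).
     if j = 0 then (if i = 0 then 1 else 0)
     else if j = n + 1 then (if i = 0 then 1 else t * u i * v 0)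
     else if i = 0 then - (v j / v 0)
     else if i \<le> j then (if i = j then 1 else 0) - t * u i * v j else 0)"
  have bB: "b \<in> Borel m"
    unfolding Borel_iff using t u v ne by (auto simp: b_def m_def upper_triangular_def)
  have bc: "b \<in> carrier_mat m m" by (simp add: b_def)
  have L: "L \<in> GL m" "L \<in> carrier_mat m m" unfolding L_def by (simp_all add: curve_mat_GL)
  obtain L' where L': "L' \<in> carrier_mat m m" "L * L' = 1\<^sub>m m" "L' * L = 1\<^sub>m m"
    using GL_inverseE[OF L(1)] .
  define G where "G = b * perm_matrix m (w' n)"
  have G: "G \<in> GL m" unfolding G_def using GL_mult_closed[of b m] bB perm_matrix_w'_GL by (auto simp: Borel_def m_def)
  have Gij: "G $$ (i, j) = b $$ (i, if j = 0 then n + 1 else if j = n + 1 then 0 else j)" if "i < m" "j < m" for i j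
    unfolding G_def using mult_perm_matrix_w'[of b n i j] bc that by (simp add: m_def)
  \<comment> \<open>The last column is the first column of \<open>L'\<close>, which \<open>L\<close>
    maps to the first unit vector.\<close>
  define a where "a = mat m m (\<lambda>(i, j). if j = n + 1 then L' $$ (i, 0)
     else if i = j then 1 else if i = 0 then - (v j / v 0) else 0)"
  have ac: "a \<in> carrier_mat m m" by (simp add: a_def)
  have La: "L * a = G"
  proof (rule eq_matI)
    fix i j assume "i < dim_row G" "j < dim_col G"
    hence ij: "i < m" "j < m" using GL_carrier[OF G] by auto
    have e: "(L * a) $$ (i, j) = (\<Sum>h<m. L $$ (i, h) * a $$ (h, j))"
      by (rule mat_mult_entry[OF L(2) ac ij])
    show "(L * a) $$ (i, j) = G $$ (i, j)"
    proof (cases "j = n + 1")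
      case True
      have "(\<Sum>h<m. L $$ (i, h) * a $$ (h, j)) = (\<Sum>h<m. L $$ (i, h) * L' $$ (h, 0))"
        using True ij by (intro sum.cong) (auto simp: a_def)
      also have "\<dots> = (L * L') $$ (i, 0)" using ij by (intro mat_mult_entry[OF L(2) L'(1), symmetric]) (auto simp: m_def)
      finally show ?thesis using e True ij L'(2) by (auto simp: Gij b_def)
    next
      case False
      have "(\<Sum>h<m. L $$ (i, h) * a $$ (h, j)) = (\<Sum>h\<in>{0, j}. L $$ (i, h) * a $$ (h, j))"
        using ij False by (intro sum.mono_neutral_right) (auto simp: a_def)
      also have "\<dots> = G $$ (i, j)"
        using ij False v by (auto simp: Gij b_def a_def L_def curve_mat_def m_def)
      finally show ?thesis using e by simp
    qed
  qed (use L ac GL_carrier[OF G] in auto)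
  \<comment> \<open>The last diagonal entry of \<open>a\<close> is a corner entry of
    \<open>L'\<close>. That it is nonzero is not computed: \<open>a\<close> is upper triangular and
    a product of invertible matrices.\<close>
  have "a = L' * G"
    unfolding La[symmetric] using assoc_mult_mat[OF L'(1) L(2) ac] L'(3) ac by simp
  moreover have "L' \<in> GL m" using GL_I[OF L'(1) L(2) L'(3,2)] .
  ultimately have "a \<in> GL m" using GL_mult_closed G by blast
  moreover have "upper_triangular a" by (auto simp: a_def upper_triangular_def m_def)
  ultimately have "a \<in> Borel m" by (simp add: Borel_def)
  hence "flag_point m L = flag_point m G" unfolding La[symmetric] using flag_point_mult_Borel[OF L(2)] by simp
  thus ?thesis using bB unfolding L_def G_def m_def by blast
qed

lemma eventually_curve_in_schubert_cell:
  assumes "u (n + 1) \<noteq> 0" "v 0 \<noteq> 0"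
  shows "\<forall>\<^sub>F t in at 0. curve (n + 2) u v t \<in> schubert_cell (n + 2) (w' n)"
proof -
  have "\<forall>\<^sub>F t in at 0. \<forall>j\<in>{..<n + 2}. poly [:1, - (u j * v j):] t \<noteq> 0"
    by (intro eventually_ball_finite ballI eventually_poly_nonzero) auto
  moreover have "\<forall>\<^sub>F t in at (0 :: complex). t \<noteq> 0" by (simp add: eventually_at_filter)
  ultimately show ?thesis
  proof eventually_elim
    case (elim t)
    thus ?case using assms by (intro curve_in_schubert_cell) (auto simp: algebra_simps)
  qed
qed

lemma schubert_cell_subset_variety: "schubert_cell (n + 2) (w' n) \<subseteq> Schubert_variety (n + 2) (w' n)"
  unfolding Schubert_variety_def
  using schubert_cell_subset by (intro closure_of_subset) (simp add: topspace_flag_top)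

lemma eventually_curve_in_Schubert_variety:
  assumes "u (n + 1) \<noteq> 0" "v 0 \<noteq> 0"
  shows "\<forall>\<^sub>F t in at 0. curve (n + 2) u v t \<in> Schubert_variety (n + 2) (w' n)"
  using eventually_curve_in_schubert_cell[of u n v, OF assms]
  by eventually_elim (use schubert_cell_subset_variety in blast)

lemma standard_flag_in_flags: "standard_flag m \<in> flags m"
  using standard_flag_in_big_cell big_cell_subset by blast

text \<open>The standard flag is approached by a curve inside the orbit as \<open>t\<close> tends to
  0, so each of its neighbourhoods meets the orbit.\<close>

lemma standard_flag_in_Schubert_variety: "standard_flag (n + 2) \<in> Schubert_variety (n + 2) (w' n)"
  unfolding Schubert_variety_def in_closure_of
proof (intro conjI allI impI)
  show "standard_flag (n + 2) \<in> topspace (flag_top (n + 2))"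
    by (simp only: topspace_flag_top standard_flag_in_flags)
  fix U assume U: "standard_flag (n + 2) \<in> U \<and> openin (flag_top (n + 2)) U"
  have "\<forall>\<^sub>F t in at 0. curve (n + 2) (\<lambda>_. 1) (\<lambda>_. 1) t \<in> U"
    using U by (intro eventually_curve_in_open) auto
  moreover have "\<forall>\<^sub>F t in at 0. curve (n + 2) (\<lambda>_. 1) (\<lambda>_. 1) t \<in> schubert_cell (n + 2) (w' n)"
    by (rule eventually_curve_in_schubert_cell) auto
  ultimately have "\<forall>\<^sub>F t in at (0 :: complex). \<exists>y. y \<in> schubert_cell (n + 2) (w' n) \<and> y \<in> U"
    by eventually_elim blast
  thus "\<exists>y. y \<in> schubert_cell (n + 2) (w' n) \<and> y \<in> U"
    using eventually_happens'[of "at (0 :: complex)"] by fastforce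
qed

lemma Schubert_variety_subset: "Schubert_variety m w \<subseteq> flags m"
  unfolding Schubert_variety_def using closure_of_subset_topspace[of "flag_top m"] by (simp add: topspace_flag_top)

lemma coord_monomial_curve:
  assumes "list_all2 (<) cs rs" "set rs \<subseteq> {..<m}"
  shows "coord_monomial m (cs, rs) (curve m u v t) =
    t ^ length cs * (prod_mset (image_mset v (mset cs)) * prod_mset (image_mset u (mset rs)))"
proof -
  have "coord_monomial m (cs, rs) (curve m u v t) =
      prod_mset (image_mset (\<lambda>j. t * v j) (mset cs)) * prod_mset (image_mset u (mset rs))"
    using assms by (rule coord_monomial_split) (simp add: coord_eq_chart chart_curve, simp add: curve_mat_def)
  moreover have "prod_mset (image_mset (\<lambda>j. t * v j) (mset cs)) = t ^ length cs * prod_mset (image_mset v (mset cs))"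
    by (induction cs) (auto simp: mult_ac)
  ultimately show ?thesis by simp
qed

section \<open>The multiplicity of the Schubert variety\<close>

lemma bigo_power_zero:
  fixes c :: complex
  assumes "(\<lambda>t. t ^ k * c) \<in> O[at 0](\<lambda>t. t ^ Suc k)"
  shows "c = 0"
proof -
  obtain K where K: "\<forall>\<^sub>F t in at 0. norm (t ^ k * c) \<le> K * norm (t ^ Suc k)"
    using assms by (rule landau_o.bigE)
  have ne: "\<forall>\<^sub>F t in at (0 :: complex). t \<noteq> 0" by (simp add: eventually_at_filter)
  have "\<forall>\<^sub>F t in at (0 :: complex). norm c \<le> K * norm t"
    using K ne
  proof eventually_elim
    case (elim t)
    hence "norm (t ^ k) * norm c \<le> norm (t ^ k) * (K * norm t)"
      by (simp add: norm_mult norm_power mult_ac)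
    thus ?case using elim(2) by (simp add: norm_power)
  qed
  moreover have "((\<lambda>t. K * norm t) \<longlongrightarrow> K * norm (0 :: complex)) (at (0 :: complex))"
    by (intro tendsto_intros)
  ultimately have "norm c \<le> K * norm (0 :: complex)"
    by (intro tendsto_lowerbound[of _ _ "at (0 :: complex)"]) auto
  thus ?thesis by simp
qed

text \<open>
  Substituting powers of distinct primes for the \<open>u\<close> and \<open>v\<close>, distinct monomials take the values
  \<open>N ^ s\<close> for distinct integers \<open>N\<close>.
\<close>

definition prime_weight :: "(nat \<Rightarrow> nat) \<Rightarrow> nat list \<times> nat list \<Rightarrow> nat" where
  "prime_weight P q = prod_mset (image_mset (\<lambda>c. P (2 * c + 1)) (mset (fst q)))
     * prod_mset (image_mset (\<lambda>r. P (2 * r)) (mset (snd q)))"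

lemma inj_on_prime_weight:
  assumes P: "inj P" "\<And>i. prime (P i)"
  shows "inj_on (prime_weight P) (staircase_pairs k a b)"
proof (rule inj_onI)
  fix q q' assume q: "q \<in> staircase_pairs k a b" "q' \<in> staircase_pairs k a b"
    and eq: "prime_weight P q = prime_weight P q'"
  \<comment> \<open>Columns are coded by odd and rows by even numbers, so one multiset of prime
    indices records both, and parity separates them again.\<close>
  define F where "F = (\<lambda>q :: nat list \<times> nat list.
     image_mset (\<lambda>c. 2 * c + 1) (mset (fst q)) + image_mset (\<lambda>r. 2 * r) (mset (snd q)))"
  have "prime_factorization (prime_weight P q) = image_mset P (F q)" for q
  proof -
    have *: "prime_weight P q = prod_mset (image_mset P (F q))"
      by (simp add: prime_weight_def F_def image_mset.compositionality comp_def)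
    show ?thesis unfolding * by (rule prime_factorization_prod_mset_primes) (use P(2) in auto)
  qed
  hence "image_mset P (F q) = image_mset P (F q')" using eq by metis
  hence "image_mset (inv_into UNIV P) (image_mset P (F q)) = image_mset (inv_into UNIV P) (image_mset P (F q'))" by simp
  hence F: "F q = F q'" using P(1) by (simp add: image_mset.compositionality comp_def)
  have "image_mset (\<lambda>x. x div 2) (filter_mset odd (F q)) = mset (fst q)"
    "image_mset (\<lambda>x. x div 2) (filter_mset even (F q)) = mset (snd q)" for q
    by (simp_all add: F_def filter_mset_image_mset image_mset.compositionality comp_def)
  hence "mset (fst q) = mset (fst q')" "mset (snd q) = mset (snd q')" using F by metis+
  moreover have "sorted (fst q)" "sorted (snd q)" "sorted (fst q')" "sorted (snd q')"
    using q by (auto simp: staircase_pairs_def)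
  ultimately show "q = q'" by (metis prod_eq_iff properties_for_sort)
qed

lemma prod_mset_of_nat_power:
  "prod_mset (image_mset (\<lambda>x. of_nat (f x) ^ s) B) = (of_nat (prod_mset (image_mset f B)) ^ s :: complex)"
  by (induction B) (auto simp: power_mult_distrib)

section \<open>Spanning: leading forms at the standard flag\<close>

locale schubert_germs =
  fixes n d :: nat and X :: "complex mat set set" and p :: "complex mat set"
  assumes d_eq: "d = n + 2" and X_eq: "X = Schubert_variety (n + 2) (w' n)"
    and p_eq: "p = standard_flag (n + 2)"
begin

sublocale germs d X p
proof
  show "p \<in> X" unfolding p_eq X_eq by (rule standard_flag_in_Schubert_variety)
  show "X \<subseteq> flags d" unfolding d_eq X_eq by (rule Schubert_variety_subset)
qed

lemma p_big_cell: "p \<in> big_cell d" and chart_p: "chart d p = 1\<^sub>m d"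
  unfolding p_eq d_eq by (rule standard_flag_in_big_cell, rule chart_standard_flag)

lemma regular_on_big_cell_reg: "regular_on_flags d (big_cell d) f \<Longrightarrow> f \<in> reg"
  unfolding regular_near_def using openin_big_cell p_big_cell by blast

lemma eq_near_big_cell: "(\<And>F. F \<in> X \<Longrightarrow> F \<in> big_cell d \<Longrightarrow> f F = g F) \<Longrightarrow> eq_near f g"
  unfolding eq_near_def using openin_big_cell p_big_cell by blast

abbreviation B where "B k \<equiv> staircase_pairs k n n"
abbreviation mon where "mon \<equiv> coord_monomial d"

definition lin :: "nat \<Rightarrow> (nat list \<times> nat list \<Rightarrow> complex) \<Rightarrow> complex mat set \<Rightarrow> complex" where
  "lin k c = (\<lambda>x. \<Sum>q\<in>B k. c q * mon q x)"

lemma B_D: "(cs, rs) \<in> B k \<Longrightarrow> list_all2 (<) cs rs \<and> set rs \<subseteq> {..<d} \<and> length cs = k"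
  by (auto simp: staircase_pairs_def d_eq)

lemma coord_order:
  assumes "c < r" "r < d"
  shows "coord d r c \<in> order_ge 1"
  using assms order_ge_1I[OF regular_on_big_cell_reg[OF regular_on_big_cell_coord[of r d c]]]
  by (simp add: coord_eq_chart chart_p)

lemma mono_order: "list_all2 (<) cs rs \<Longrightarrow> set rs \<subseteq> {..<d} \<Longrightarrow> mon (cs, rs) \<in> order_ge (length cs)"
proof (induction cs rs rule: list_all2_induct)
  case Nil
  show ?case using reg_const[of 1] by (simp add: order_ge_0)
next
  case (Cons c cs r rs)
  have "coord d r c \<in> order_ge 1" using Cons.hyps Cons.prems by (intro coord_order) auto
  from order_ge_mult[OF this] Cons show ?case by simp
qed

lemma mono_B_order: "q \<in> B k \<Longrightarrow> mon q \<in> order_ge k"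
proof (cases q)
  case (Pair cs rs)
  assume "q \<in> B k"
  with B_D[of cs rs k] mono_order[of cs rs] show ?thesis unfolding Pair by auto
qed

lemma lin_order: "lin k c \<in> order_ge k"
  unfolding lin_def by (intro order_ge_sum order_ge_mult_reg reg_const mono_B_order)

lemma lin_add: "lin k (\<lambda>q. a q + b q) = (\<lambda>x. lin k a x + lin k b x)"
  by (simp add: lin_def sum.distrib distrib_right)

lemma lin_scale: "lin k (\<lambda>q. s * a q) = (\<lambda>x. s * lin k a x)"
  by (simp add: lin_def sum_distrib_left mult_ac)

lemma lin_single: "q \<in> B k \<Longrightarrow> lin k (\<lambda>q'. if q' = q then 1 else 0) = mon q"
  unfolding lin_def by (rule ext) (simp add: if_distrib[of "\<lambda>z. z * _"] finite_staircase_pairs cong: if_cong)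

text \<open>Different products can sort to the same monomial, so the coefficients are added up over
  the fibres of \<open>h\<close>.\<close>

lemma lin_image:
  assumes "finite I" "\<And>i. i \<in> I \<Longrightarrow> h i \<in> B k"
  obtains c where "lin k c = (\<lambda>x. \<Sum>i\<in>I. a i * mon (h i) x)"
proof
  show "lin k (\<lambda>q. \<Sum>i\<in>{i \<in> I. h i = q}. a i) = (\<lambda>x. \<Sum>i\<in>I. a i * mon (h i) x)"
  proof
    fix x
    have "lin k (\<lambda>q. \<Sum>i\<in>{i \<in> I. h i = q}. a i) x = (\<Sum>q\<in>B k. \<Sum>i\<in>{i \<in> I. h i = q}. a i * mon (h i) x)"
      by (simp add: lin_def sum_distrib_right)
    also have "\<dots> = (\<Sum>i\<in>I. a i * mon (h i) x)"
      using assms by (intro sum.group) (auto simp: finite_staircase_pairs)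
    finally show "lin k (\<lambda>q. \<Sum>i\<in>{i \<in> I. h i = q}. a i) x = (\<Sum>i\<in>I. a i * mon (h i) x)" .
  qed
qed

text \<open>The straightening rule: on \<open>X\<close> a monomial depends only on its two multisets
  of indices, and \<open>list_all2_less_insort\<close> keeps the sorted one in the
  staircase.\<close>

lemma mono_insort:
  assumes q: "q \<in> B 1" "q' \<in> B k"
  defines "h \<equiv> (insort (hd (fst q)) (fst q'), insort (hd (snd q)) (snd q'))"
  shows "h \<in> B (Suc k)" "\<And>F. F \<in> X \<Longrightarrow> F \<in> big_cell d \<Longrightarrow> mon q F * mon q' F = mon h F"
proof -
  obtain cs rs where q': "q' = (cs, rs)" by (cases q')
  obtain c r where qcr: "q = ([c], [r])" "c < r" "c \<le> n" "r \<le> Suc n"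
    using q(1) by (auto simp: staircase_pairs_def length_Suc_conv list_all2_Cons1)
  have B': "list_all2 (<) cs rs" "sorted cs" "sorted rs" "length cs = k" "set cs \<subseteq> {..n}" "set rs \<subseteq> {..Suc n}"
    using q(2) q' by (auto simp: staircase_pairs_def)
  have h: "h = (insort c cs, insort r rs)" by (simp add: h_def qcr q')
  have la: "list_all2 (<) (insort c cs) (insort r rs)"
    by (rule list_all2_less_insort) (use B' qcr in auto)
  show "h \<in> B (Suc k)"
    using la B' qcr unfolding h by (auto simp: staircase_pairs_def sorted_insort set_insort_key)
  fix F assume F: "F \<in> X" "F \<in> big_cell d"
  have "mon (c # cs, r # rs) F = mon (insort c cs, insort r rs) F"
    unfolding d_eq using F la B' qcr
    by (intro coord_monomial_eq_on_Schubert_variety) (auto simp: d_eq X_eq)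
  thus "mon q F * mon q' F = mon h F" by (simp add: qcr q' h)
qed

lemma lin_mult: "\<exists>c. eq_near (\<lambda>x. lin 1 a x * lin k b x) (lin (Suc k) c)"
proof -
  define h where "h = (\<lambda>(q, q'). (insort (hd (fst q)) (fst q' :: nat list), insort (hd (snd q)) (snd q' :: nat list)))"
  obtain c where c: "lin (Suc k) c = (\<lambda>x. \<Sum>i\<in>B 1 \<times> B k. (a (fst i) * b (snd i)) * mon (h i) x)"
    by (rule lin_image[of "B 1 \<times> B k" h "Suc k" "\<lambda>i. a (fst i) * b (snd i)"])
      (auto simp: finite_staircase_pairs h_def intro: mono_insort)
  show ?thesis
  proof (intro exI[of _ c], rule eq_near_big_cell)
    fix F assume F: "F \<in> X" "F \<in> big_cell d"
    have "lin 1 a F * lin k b F = (\<Sum>i\<in>B 1 \<times> B k. (a (fst i) * mon (fst i) F) * (b (snd i) * mon (snd i) F))"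
      unfolding lin_def sum_product by (simp add: sum.cartesian_product case_prod_beta)
    also have "\<dots> = lin (Suc k) c F"
      unfolding c
    proof (intro sum.cong refl)
      fix i assume "i \<in> B 1 \<times> B k"
      hence *: "mon (h i) F = mon (fst i) F * mon (snd i) F"
        unfolding h_def case_prod_beta using F by (intro mono_insort(2)[symmetric]) auto
      show "(a (fst i) * mon (fst i) F) * (b (snd i) * mon (snd i) F) = (a (fst i) * b (snd i)) * mon (h i) F"
        unfolding * by (simp only: mult_ac)
    qed
    finally show "lin 1 a F * lin k b F = lin (Suc k) c F" .
  qed
qed

lemma regular_on_big_cell_poly_chart:
  assumes "a \<in> poly_funs d"
  shows "regular_on_flags d (big_cell d) (\<lambda>F. a (chart d F))"
  using assms
proof (induction rule: poly_funs.induct)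
  case (const c)
  show ?case by (rule regular_on_flags_const[OF openin_big_cell])
next
  case (entry i j)
  thus ?case using regular_on_big_cell_coord[of i d j] by (simp add: chart_def)
qed (use regular_on_flags_combine[of d "big_cell d" _ "big_cell d"] in simp_all)

text \<open>The Taylor expansion at the identity to first order. Only entries below the diagonal
  contribute; the others are constant on the big cell.\<close>

lemma poly_chart_linear:
  assumes "a \<in> poly_funs d"
  shows "\<exists>c. (\<lambda>F. a (chart d F) - a (1\<^sub>m d) - lin 1 c F) \<in> order_ge 2"
  using assms
proof (induction rule: poly_funs.induct)
  case (const a)
  have "lin 1 (\<lambda>_. 0) = (\<lambda>_. 0)" by (simp add: lin_def)
  thus ?case using order_ge_zero[of 2] by (intro exI[of _ "\<lambda>_. 0"]) simp
next
  case (entry i j)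
  show ?case
  proof (cases "j < i")
    case True
    have "([j], [i]) \<in> B 1" using entry True by (auto simp: staircase_pairs_def d_eq)
    from lin_single[OF this] entry True order_ge_zero[of 2] show ?thesis
      by (intro exI[of _ "\<lambda>q'. if q' = ([j], [i]) then 1 else 0"]) (simp add: chart_def)
  next
    case False
    have l0: "lin 1 (\<lambda>_. 0) = (\<lambda>_. 0)" by (simp add: lin_def)
    have "eq_near (\<lambda>_. 0) (\<lambda>F. chart d F $$ (i, j) - 1\<^sub>m d $$ (i, j) - lin 1 (\<lambda>_. 0) F)"
      unfolding l0 using entry False coord_big_cell_diag coord_big_cell_upper
      by (intro eq_near_big_cell) (auto simp: chart_def)
    from order_ge_cong[OF order_ge_zero this] show ?thesis by blast
  qed
next
  case (add a b)
  then obtain c c' where "(\<lambda>F. a (chart d F) - a (1\<^sub>m d) - lin 1 c F) \<in> order_ge 2"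
    "(\<lambda>F. b (chart d F) - b (1\<^sub>m d) - lin 1 c' F) \<in> order_ge 2" by blast
  from order_ge_add[OF this] show ?case
    by (intro exI[of _ "\<lambda>q. c q + c' q"]) (simp add: lin_add algebra_simps)
next
  case (mult a b)
  define a0 b0 where "a0 = a (1\<^sub>m d)" "b0 = b (1\<^sub>m d)"
  from mult obtain c c' where c: "(\<lambda>F. a (chart d F) - a0 - lin 1 c F) \<in> order_ge 2"
    "(\<lambda>F. b (chart d F) - b0 - lin 1 c' F) \<in> order_ge 2" unfolding a0_b0_def by blast
  have breg: "(\<lambda>F. b (chart d F)) \<in> reg"
    by (rule regular_on_big_cell_reg[OF regular_on_big_cell_poly_chart[OF mult.hyps(2)]])
  have "(\<lambda>F. b (chart d F) - b0) \<in> order_ge (Suc 0)"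
    by (rule order_ge_1I[OF reg_diff[OF breg reg_const]]) (simp add: chart_p a0_b0_def)
  from order_ge_mult[OF lin_order this, of 1 c]
  have 1: "(\<lambda>F. lin 1 c F * (b (chart d F) - b0)) \<in> order_ge 2" by (simp add: numeral_2_eq_2)
  \<comment> \<open>The product rule. In the mixed term both factors vanish at \<open>p\<close>, so
    it has order 2.\<close>
  have "(\<lambda>F. (a0 * (b (chart d F) - b0 - lin 1 c' F) + lin 1 c F * (b (chart d F) - b0)) +
     b (chart d F) * (a (chart d F) - a0 - lin 1 c F)) \<in> order_ge 2"
    by (intro order_ge_add order_ge_mult_reg[OF reg_const c(2)] 1 order_ge_mult_reg[OF breg c(1)])
  also have "(\<lambda>F. (a0 * (b (chart d F) - b0 - lin 1 c' F) + lin 1 c F * (b (chart d F) - b0)) +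
     b (chart d F) * (a (chart d F) - a0 - lin 1 c F)) =
     (\<lambda>F. a (chart d F) * b (chart d F) - a0 * b0 - lin 1 (\<lambda>q. a0 * c' q + b0 * c q) F)"
    by (simp only: lin_add lin_scale) (simp add: algebra_simps)
  finally show ?case unfolding a0_b0_def by blast
qed

lemma maximal_ideal_linear:
  assumes f: "f \<in> reg" "f p = 0"
  shows "\<exists>c. (\<lambda>F. f F - lin 1 c F) \<in> order_ge 2"
proof -
  obtain U h where U: "openin (flag_top d) U" "p \<in> U" "regular_on_flags d U h" "\<forall>x\<in>X \<inter> U. f x = h x"
    using f(1) unfolding regular_near_def by blast
  have pf: "p = flag_point d (1\<^sub>m d)" by (simp add: p_eq d_eq standard_flag_def)
  have "1\<^sub>m d \<in> GL d" using one_in_Borel[of d] by (simp add: Borel_def)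
  then obtain a b W where W: "a \<in> poly_funs d" "b \<in> poly_funs d" "openin (GL_top d) W" "1\<^sub>m d \<in> W"
    "\<And>x. x \<in> W \<Longrightarrow> x \<in> GL d \<and> flag_point d x \<in> U \<and> b x \<noteq> 0 \<and> h (flag_point d x) = a x / b x"
    using regular_on_flagsE[OF U(3), of "1\<^sub>m d"] U(2) unfolding pf by metis
  obtain q where q: "q \<in> poly_funs d" "q (1\<^sub>m d) \<noteq> 0" "{x \<in> GL d. q x \<noteq> 0} \<subseteq> W"
    using openin_GL_topE[OF W(3,4)] .
  \<comment> \<open>On the big cell \<open>chart d F\<close> represents \<open>F\<close>, so
    evaluating the local fraction \<open>a / b\<close> there expresses \<open>f\<close> near
    \<open>p\<close> by functions of the flag.\<close>
  define a' b' where "a' = (\<lambda>F. a (chart d F))" and "b' = (\<lambda>F. b (chart d F))"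
  have ab: "a' \<in> reg" "b' \<in> reg"
    unfolding a'_def b'_def using W(1,2) by (auto intro: regular_on_big_cell_reg regular_on_big_cell_poly_chart)
  have "b' p \<noteq> 0" using W(4,5) by (simp add: b'_def chart_p)
  hence w: "(\<lambda>x. 1 / b' x) \<in> reg" using regular_near_inverse[OF ab(2) _ point_mem variety_subset] by blast
  have eq: "eq_near f (\<lambda>x. 1 / b' x * a' x)"
    unfolding eq_near_def
  proof (intro exI conjI ballI)
    show "openin (flag_top d) {F \<in> big_cell d. q (chart d F) \<noteq> 0}"
      by (rule openin_flag_nonvanishing[OF regular_on_big_cell_poly_chart[OF q(1)] big_cell_subset])
    show "p \<in> {F \<in> big_cell d. q (chart d F) \<noteq> 0}" using p_big_cell q(2) by (simp add: chart_p)
    fix x assume x: "x \<in> X \<inter> {F \<in> big_cell d. q (chart d F) \<noteq> 0}"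
    hence "chart d x \<in> W" "flag_point d (chart d x) = x" using q(3) chart_big_cell[of x d] by auto
    with W(5)[of "chart d x"] show "f x = 1 / b' x * a' x" using U(4) x by (simp add: a'_def b'_def)
  qed
  have "a (1\<^sub>m d) = 0"
    using eq_near_point[OF eq] f(2) \<open>b' p \<noteq> 0\<close> by (simp add: a'_def chart_p)
  then obtain c where c: "(\<lambda>F. a' F - lin 1 c F) \<in> order_ge 2"
    using poly_chart_linear[OF W(1)] unfolding a'_def by auto
  \<comment> \<open>To first order the unit \<open>1 / b'\<close> acts on a linear form as its value
    at \<open>p\<close>.\<close>
  define w0 where "w0 = 1 / b' p"
  have "(\<lambda>F. 1 / b' F - w0) \<in> order_ge (Suc 0)"
    by (rule order_ge_1I[OF reg_diff[OF w reg_const]]) (simp add: w0_def)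
  from order_ge_mult[OF this lin_order, of 1 c]
  have "(\<lambda>F. (1 / b' F - w0) * lin 1 c F) \<in> order_ge 2" by (simp add: numeral_2_eq_2)
  from order_ge_add[OF order_ge_mult_reg[OF w c] this]
  have "(\<lambda>F. 1 / b' F * (a' F - lin 1 c F) + (1 / b' F - w0) * lin 1 c F) \<in> order_ge 2" .
  also have "(\<lambda>F. 1 / b' F * (a' F - lin 1 c F) + (1 / b' F - w0) * lin 1 c F) =
     (\<lambda>F. 1 / b' F * a' F - lin 1 (\<lambda>q. w0 * c q) F)"
    by (simp only: lin_scale) (simp add: algebra_simps)
  finally have "(\<lambda>F. 1 / b' F * a' F - lin 1 (\<lambda>q. w0 * c q) F) \<in> order_ge 2" .
  moreover have "eq_near (\<lambda>F. 1 / b' F * a' F - lin 1 (\<lambda>q. w0 * c q) F) (\<lambda>F. f F - lin 1 (\<lambda>q. w0 * c q) F)"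
    using eq unfolding eq_near_def by metis
  ultimately show ?thesis using order_ge_cong by blast
qed

text \<open>A product \<open>f * g\<close> may be replaced by the product of the leading forms
  \<open>l\<close> of \<open>f\<close> and \<open>l'\<close> of \<open>g\<close>, as
  \<open>f * g - l * l' = l * (g - l') + (f - l) * g\<close> has order \<open>k + 2\<close>. The
  product \<open>l * l'\<close> is then straightened by \<open>lin_mult\<close>.\<close>

lemma order_ge_span:
  assumes "f \<in> order_ge k"
  shows "\<exists>c. (\<lambda>F. f F - lin k c F) \<in> order_ge (Suc k)"
  using assms
proof (induction k arbitrary: f)
  case 0
  hence "(\<lambda>F. f F - f p) \<in> order_ge (Suc 0)"
    using reg_const by (intro order_ge_1I reg_diff) (auto simp: order_ge_0)
  moreover have "lin 0 (\<lambda>_. f p) = (\<lambda>_. f p)" by (simp add: lin_def staircase_pairs_0)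
  ultimately show ?case by (intro exI[of _ "\<lambda>_. f p"]) simp
next
  case (Suc k)
  from Suc.prems show ?case
  proof (induction rule: order_ge_Suc_induct)
    case (mult f g)
    obtain a where a: "(\<lambda>F. f F - lin 1 a F) \<in> order_ge 2" using maximal_ideal_linear mult(1,2) by blast
    obtain b where b: "(\<lambda>F. g F - lin k b F) \<in> order_ge (Suc k)" using Suc.IH[OF mult(3)] by blast
    obtain c where c: "eq_near (\<lambda>x. lin 1 a x * lin k b x) (lin (Suc k) c)" using lin_mult by blast
    have "(\<lambda>F. lin 1 a F * (g F - lin k b F)) \<in> order_ge (Suc (Suc k))"
      "(\<lambda>F. (f F - lin 1 a F) * g F) \<in> order_ge (Suc (Suc k))"
      using order_ge_mult[OF lin_order b, of 1 a] order_ge_mult[OF a mult(3)] by simp_all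
    from order_ge_add[OF this]
    have "(\<lambda>F. f F * g F - lin 1 a F * lin k b F) \<in> order_ge (Suc (Suc k))" by (simp add: algebra_simps)
    moreover have "eq_near (\<lambda>F. f F * g F - lin 1 a F * lin k b F) (\<lambda>F. f F * g F - lin (Suc k) c F)"
      using c unfolding eq_near_def by metis
    ultimately show ?case using order_ge_cong by blast
  next
    case (add f g)
    then obtain a b where "(\<lambda>F. f F - lin (Suc k) a F) \<in> order_ge (Suc (Suc k))"
      "(\<lambda>F. g F - lin (Suc k) b F) \<in> order_ge (Suc (Suc k))" by blast
    from order_ge_add[OF this] show ?case
      by (intro exI[of _ "\<lambda>q. a q + b q"]) (simp add: lin_add algebra_simps)
  next
    case (cong f g)
    then obtain a where a: "(\<lambda>F. f F - lin (Suc k) a F) \<in> order_ge (Suc (Suc k))" by blast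
    have "eq_near (\<lambda>F. f F - lin (Suc k) a F) (\<lambda>F. g F - lin (Suc k) a F)"
      using \<open>eq_near f g\<close> unfolding eq_near_def by metis
    with a show ?case using order_ge_cong by blast
  qed
qed

section \<open>Independence: orders of vanishing along curves\<close>

lemma eq_near_curve:
  assumes "u (n + 1) \<noteq> 0" "v 0 \<noteq> 0" "eq_near f g"
  shows "\<forall>\<^sub>F t in at 0. f (curve d u v t) = g (curve d u v t)"
proof -
  obtain U where U: "openin (flag_top d) U" "p \<in> U" "\<forall>x\<in>X \<inter> U. f x = g x"
    using assms(3) unfolding eq_near_def by blast
  have "\<forall>\<^sub>F t in at 0. curve d u v t \<in> U"
    using U(1,2) by (intro eventually_curve_in_open) (simp_all add: p_eq d_eq)
  \<comment> \<open>Germs see only values on \<open>X\<close>, hence the conditions on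
    \<open>u\<close> and \<open>v\<close>, which keep the curve in \<open>X\<close> for small
    nonzero \<open>t\<close>.\<close>
  moreover have "\<forall>\<^sub>F t in at 0. curve d u v t \<in> X"
    unfolding X_eq d_eq by (rule eventually_curve_in_Schubert_variety[of u n v, OF assms(1,2)])
  ultimately show ?thesis by eventually_elim (use U(3) in blast)
qed

lemma reg_curve:
  assumes uv: "u (n + 1) \<noteq> 0" "v 0 \<noteq> 0" and f: "f \<in> reg"
  obtains a b where "poly b 0 \<noteq> 0" "f p = poly a 0 / poly b 0"
    "\<forall>\<^sub>F t in at 0. f (curve d u v t) = poly a t / poly b t"
proof -
  obtain U h where U: "openin (flag_top d) U" "p \<in> U" "regular_on_flags d U h" "\<forall>x\<in>X \<inter> U. f x = h x"
    using f(1) unfolding regular_near_def by blast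
  have pf: "p = flag_point d (1\<^sub>m d)" by (simp add: p_eq d_eq standard_flag_def)
  have "1\<^sub>m d \<in> GL d" using one_in_Borel[of d] by (simp add: Borel_def)
  then obtain a b W where W: "a \<in> poly_funs d" "b \<in> poly_funs d" "openin (GL_top d) W" "1\<^sub>m d \<in> W"
    "\<And>x. x \<in> W \<Longrightarrow> x \<in> GL d \<and> flag_point d x \<in> U \<and> b x \<noteq> 0 \<and> h (flag_point d x) = a x / b x"
    using regular_on_flagsE[OF U(3), of "1\<^sub>m d"] U(2) unfolding pf by metis
  obtain a' where a': "\<And>t. a (curve_mat d u v t) = poly a' t" using poly_funs_curve[OF W(1)] by blast
  obtain b' where b': "\<And>t. b (curve_mat d u v t) = poly b' t" using poly_funs_curve[OF W(2)] by blast
  have 0: "a (1\<^sub>m d) = poly a' 0" "b (1\<^sub>m d) = poly b' 0"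
    using a'[of 0] b'[of 0] by (simp_all add: curve_mat_0)
  have "eq_near f h" using U unfolding eq_near_def by blast
  from eq_near_curve[of u v, OF uv this]
  have "\<forall>\<^sub>F t in at 0. f (curve d u v t) = h (curve d u v t)" .
  moreover have "\<forall>\<^sub>F t in at 0. curve_mat d u v t \<in> W"
    by (rule eventually_curve_in_GL_open[OF W(3,4)])
  ultimately have "\<forall>\<^sub>F t in at 0. f (curve d u v t) = poly a' t / poly b' t"
    by eventually_elim (use W(5) a' b' in simp)
  moreover have "f p = poly a' 0 / poly b' 0"
    using eq_near_point[OF \<open>eq_near f h\<close>] W(5)[OF W(4)] by (simp add: pf 0)
  moreover have "poly b' 0 \<noteq> 0" using W(5)[OF W(4)] 0 by simp
  ultimately show ?thesis using that by blast
qed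

lemma reg_curve_bigo:
  assumes uv: "u (n + 1) \<noteq> 0" "v 0 \<noteq> 0" and f: "f \<in> reg"
  shows "(\<lambda>t. f (curve d u v t)) \<in> O[at 0](\<lambda>_. 1)"
    and "f p = 0 \<Longrightarrow> (\<lambda>t. f (curve d u v t)) \<in> O[at 0](\<lambda>t. t)"
proof -
  obtain a b where ab: "poly b 0 \<noteq> 0" "f p = poly a 0 / poly b 0"
    "\<forall>\<^sub>F t in at 0. f (curve d u v t) = poly a t / poly b t"
    using reg_curve[of u v, OF uv f] .
  have lim: "((\<lambda>t. poly a t / poly b t) \<longlongrightarrow> poly a 0 / poly b 0) (at 0)" for a
    using ab(1) by (intro tendsto_divide isContD[OF poly_isCont])
  show "(\<lambda>t. f (curve d u v t)) \<in> O[at 0](\<lambda>_. 1)"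
  proof (rule bigoI_tendsto)
    show "((\<lambda>t. f (curve d u v t) / 1) \<longlongrightarrow> poly a 0 / poly b 0) (at 0)"
      using ab(3) by (intro Lim_transform_eventually[OF lim[of a]]) (auto elim: eventually_mono)
  qed simp
  assume "f p = 0"
  hence "poly a 0 = 0" using ab by simp
  then obtain a' where a': "a = [:0, 1:] * a'" using poly_eq_0_iff_dvd[of a 0] by auto
  have ne: "\<forall>\<^sub>F t in at (0 :: complex). t \<noteq> 0" by (simp add: eventually_at_filter)
  show "(\<lambda>t. f (curve d u v t)) \<in> O[at 0](\<lambda>t. t)"
  proof (rule bigoI_tendsto[OF _ ne])
    have "\<forall>\<^sub>F t in at 0. poly a' t / poly b t = f (curve d u v t) / t"
      using ab(3) ne by eventually_elim (simp add: a')
    thus "((\<lambda>t. f (curve d u v t) / t) \<longlongrightarrow> poly a' 0 / poly b 0) (at 0)"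
      by (rule Lim_transform_eventually[OF lim[of a']])
  qed
qed

lemma order_ge_curve:
  assumes uv: "u (n + 1) \<noteq> 0" "v 0 \<noteq> 0" and f: "f \<in> order_ge k"
  shows "(\<lambda>t. f (curve d u v t)) \<in> O[at 0](\<lambda>t. t ^ k)"
  using f
proof (induction k arbitrary: f)
  case 0
  thus ?case using reg_curve_bigo(1)[of u v, OF uv] by (simp add: order_ge_0)
next
  case (Suc k)
  from Suc.prems show ?case
  proof (induction rule: order_ge_Suc_induct)
    case (mult f g)
    have "(\<lambda>t. f (curve d u v t)) \<in> O[at 0](\<lambda>t. t)" using reg_curve_bigo(2)[of u v, OF uv] mult(1,2) by blast
    from landau_o.big.mult[OF this Suc.IH[OF mult(3)]] show ?case by simp
  next
    case (add f g)
    thus ?case by (intro sum_in_bigo)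
  next
    case (cong f g)
    thus ?case using landau_o.big.in_cong[OF eq_near_curve[of u v, OF uv \<open>eq_near f g\<close>]] cong by blast
  qed
qed

lemma monomials_independent:
  assumes lin: "lin k c \<in> order_ge (Suc k)" and q: "q \<in> B k"
  shows "c q = 0"
proof -
  have "infinite {p :: nat. prime p}" by (rule primes_infinite)
  then obtain P :: "nat \<Rightarrow> nat" where P: "inj P" "range P \<subseteq> {p. prime p}"
    using infinite_countable_subset by blast
  have prime: "prime (P i)" for i using P(2) by auto
  have "(\<Sum>q\<in>B k. c q * of_nat (prime_weight P q) ^ s) = 0" for s
  proof -
    \<comment> \<open>One curve for each exponent \<open>s\<close>. All values are nonzero, also for
      \<open>s = 0\<close>, so the curve is admissible.\<close>
    define u v :: "nat \<Rightarrow> complex" where "u = (\<lambda>r. of_nat (P (2 * r)) ^ s)" and "v = (\<lambda>c. of_nat (P (2 * c + 1)) ^ s)"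
    have "P i \<noteq> 0" for i using prime[of i] by (metis not_prime_0)
    hence uv: "u (n + 1) \<noteq> 0" "v 0 \<noteq> 0" by (simp_all add: u_def v_def)
    have m: "mon q (curve d u v t) = t ^ k * of_nat (prime_weight P q) ^ s" if q: "q \<in> B k" for q t
    proof -
      obtain cs rs where q': "q = (cs, rs)" by (cases q)
      from B_D[of cs rs k] q have B: "list_all2 (<) cs rs" "set rs \<subseteq> {..<d}" "length cs = k"
        unfolding q' by auto
      show ?thesis unfolding q' coord_monomial_curve[OF B(1,2)] B(3)
        by (simp add: u_def v_def prod_mset_of_nat_power[of "\<lambda>c. P (2 * c + 1)", simplified]
          prod_mset_of_nat_power[of "\<lambda>c. P (2 * c)", simplified] prime_weight_def power_mult_distrib)
    qed
    \<comment> \<open>Along this curve the combination is exactly a constant times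
      \<open>t\<^sup>k\<close>; being \<open>O(t\<^sup>k\<^sup>+\<^sup>1)\<close>, it must have
      constant 0. The constants for all \<open>s\<close> are the power sums to which
      \<open>power_sums_independent\<close> applies.\<close>
    have "(\<lambda>t. lin k c (curve d u v t)) = (\<lambda>t. t ^ k * (\<Sum>q\<in>B k. c q * of_nat (prime_weight P q) ^ s))"
      unfolding lin_def sum_distrib_left by (intro ext sum.cong) (auto simp: m mult_ac)
    with order_ge_curve[of u v, OF uv lin] show ?thesis by (intro bigo_power_zero[of k]) simp
  qed
  moreover have "inj_on (\<lambda>q. of_nat (prime_weight P q) :: complex) (B k)"
    using inj_on_prime_weight[OF P(1) prime] by (auto simp: inj_on_def)
  ultimately show ?thesis
    using power_sums_independent[OF finite_staircase_pairs, of "\<lambda>q. of_nat (prime_weight P q)" k n n c q] q by blast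
qed

lemma gr_Hilbert_function_Schubert:
  "gr_Hilbert_function R (local_constants d X p) M k = card (B k)"
proof (rule gr_Hilbert_function_local_ring[where e = mon])
  show "mon q \<in> order_ge k" if "q \<in> B k" for q using that by (rule mono_B_order)
  show "c q = 0" if "(\<lambda>x. \<Sum>i\<in>B k. c i * mon i x) \<in> order_ge (Suc k)" "q \<in> B k" for c q
    using monomials_independent[of k c q] that by (simp add: lin_def)
  show "\<exists>c. (\<lambda>x. f x - (\<Sum>i\<in>B k. c i * mon i x)) \<in> order_ge (Suc k)" if "f \<in> order_ge k" for f
    using order_ge_span[OF that] by (simp add: lin_def)
qed (rule finite_staircase_pairs)

end

theorem mainTheorem5:
  fixes n :: nat
  assumes "n \<ge> 1"
  shows "multiplicity_at (n + 2) (Schubert_variety (n + 2) (w' n)) (standard_flag (n + 2))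
           = 1 / (of_nat n + 1) * of_nat ((2 * n) choose n)"
proof -
  interpret schubert_germs n "n + 2" "Schubert_variety (n + 2) (w' n)" "standard_flag (n + 2)"
    by unfold_locales simp_all
  show ?thesis
    unfolding multiplicity_at_def using assms
  proof (rule projective_degree_ballot)
    show "int (gr_Hilbert_function R (local_constants (n + 2) (Schubert_variety (n + 2) (w' n)) (standard_flag (n + 2))) M k)
      = int ((n + k) choose k) * int ((n + k) choose k) - int ((n + k) choose (Suc k)) * int ((n + k) choose (Suc n))" for k
      unfolding gr_Hilbert_function_Schubert by (rule card_staircase_pairs) simp
  qed
qed

end
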